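(* Let $T$ be an aperiodic countable-to-one measure-preserving Borel transformation on a standard probability space $(X,\mu)$, with $T$ surjective and $E_T$ null-preserving, and let $\rho$ be the Radon--Nikodym cocycle of $E_T$ with respect to $\mu$. Let $f\in L^1(X,\mu)$, and define $f^*(x):=\sup_{\tau_x\in\mathcal{T}_x}A_f^\rho[\tau_x]$ for each $x\in X$. Then for any $\lambda\in\mathbb{R}$, \[ \int_{\{f^*>\lambda\}}f\,d\mu\ \ge\ \lambda\,\mu\{f^*>\lambda\}. \] In particular, $f^*<\infty$ a.e.
   Context: $\mathbb{N}$ includes $0$. $T$ is aperiodic if $T^n(x)\ne x$ for all $x\in X$ and $n\ge1$; countable-to-one if all $T^{-1}(x)$ are countable. $x\,E_T\,y$ iff $T^n(x)=T^m(y)$ for some $n,m\in\mathbb{N}$. A countable Borel equivalence relation $E$ on $(X,\mu)$ is null-preserving if for every partial Borel injection $\gamma$ on $X$ with graph contained in $E$, $\mathrm{dom}(\gamma)$ is null iff $\mathrm{im}(\gamma)$ is null. (The assumptions that $T$ is surjective and $E_T$ is null-preserving can be arranged by discarding a null set and are a standing convention.) The Radon--Nikodym cocycle of $E$ with respect to $\mu$ is the a.e. unique Borel function $\rho:E\to\mathbb{R}^+$, $(x,y)\mapsto\rho_x(y)$, with $\rho_x(y)\rho_y(z)=\rho_x(z)$ and $\int_{\mathrm{im}(\gamma)}h\,d\mu=\int_{\mathrm{dom}(\gamma)}h(\gamma(x))\rho_x(\gamma(x))\,d\mu(x)$ for all $h\in L^1(X,\mu)$ and all partial Borel injections $\gamma$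 with graph contained in $E$. $\mathcal{T}_x$ is the collection of (possibly infinite) subtrees of the graph of $T$ of finite height rooted at $x$ and directed towards $x$: $\tau_x\in\mathcal{T}_x$ iff $\tau_x\subseteq\bigcup_{i=0}^nT^{-i}(x)$ for some $n\in\mathbb{N}$; $x\in\tau_x$; and if $y\in\tau_x$, $y\ne x$, then $T(y)\in\tau_x$. For a nonempty subset $J$ of the $E_T$-class of $x$, $\rho_x(J):=\sum_{y\in J}\rho_x(y)$ and $A_f^\rho[J]:=\frac{1}{\rho_x(J)}\sum_{y\in J}f(y)\rho_x(y)$ (independent of the choice of $x$ in the class; for a.e. $x$ these sums converge absolutely for all $J=\tau_x\in\mathcal{T}_x$, and statements are understood modulo null sets). *)

theory Defs
  imports "HOL-Probability.Probability"
begin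

definition aperiodic :: "('a \<Rightarrow> 'a) \<Rightarrow> bool" where
  "aperiodic T \<longleftrightarrow> (\<forall>x. \<forall>n\<ge>1. (T ^^ n) x \<noteq> x)"

definition countable_to_one :: "('a \<Rightarrow> 'a) \<Rightarrow> bool" where
  "countable_to_one T \<longleftrightarrow> (\<forall>x. countable (T -` {x}))"

definition measure_preserving :: "'a measure \<Rightarrow> ('a \<Rightarrow> 'a) \<Rightarrow> bool" where
  "measure_preserving M T \<longleftrightarrow> T \<in> measurable M M \<and> distr M M T = M"

definition orbit_eqrel :: "('a \<Rightarrow> 'a) \<Rightarrow> ('a \<times> 'a) set" where
  "orbit_eqrel T = {(x, y). \<exists>n m. (T ^^ n) x = (T ^^ m) y}"

text \<open>
  A partial Borel injection is given by its domain \<open>A\<close> and a map \<open>g\<close> whose values outside \<open>A\<close>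
  are irrelevant.  In a standard Borel space the image \<open>g ` A\<close> is automatically Borel
  (Lusin--Souslin), so this is not part of the definition.
\<close>

definition partial_borel_injection ::
    "'a measure \<Rightarrow> ('a \<times> 'a) set \<Rightarrow> 'a set \<Rightarrow> ('a \<Rightarrow> 'a) \<Rightarrow> bool" where
  "partial_borel_injection M E A g \<longleftrightarrow>
     A \<in> sets M \<and> g \<in> measurable (restrict_space M A) M \<and> inj_on g A \<and> (\<forall>x\<in>A. (x, g x) \<in> E)"

definition null_preserving :: "'a measure \<Rightarrow> ('a \<times> 'a) set \<Rightarrow> bool" where
  "null_preserving M E \<longleftrightarrow>
     (\<forall>A g. partial_borel_injection M E A g \<longrightarrow> (A \<in> null_sets M \<longleftrightarrow> g ` A \<in> null_sets M))"

text \<open>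
  \<open>\<rho> x y\<close> stands for $\rho_x(y)$; only its values on \<open>E\<close> matter.  Integrability of the transported
  function is stated explicitly because the Bochner integral of a non-integrable function is \<open>0\<close>.
\<close>

definition RN_cocycle ::
    "'a measure \<Rightarrow> ('a \<times> 'a) set \<Rightarrow> ('a \<Rightarrow> 'a \<Rightarrow> real) \<Rightarrow> bool" where
  "RN_cocycle M E \<rho> \<longleftrightarrow>
     (\<lambda>(x, y). \<rho> x y) \<in> borel_measurable (restrict_space (M \<Otimes>\<^sub>M M) E) \<and>
     (\<forall>(x, y)\<in>E. \<rho> x y > 0) \<and>
     (\<forall>x y z. (x, y) \<in> E \<longrightarrow> (y, z) \<in> E \<longrightarrow> \<rho> x y * \<rho> y z = \<rho> x z) \<and>
     (\<forall>A g. \<forall>h :: 'a \<Rightarrow> real. partial_borel_injection M E A g \<longrightarrow> integrable M h \<longrightarrow>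
        set_integrable M A (\<lambda>x. h (g x) * \<rho> x (g x)) \<and>
        (LINT y:g ` A|M. h y) = (LINT x:A|M. h (g x) * \<rho> x (g x)))"

definition rooted_trees :: "('a \<Rightarrow> 'a) \<Rightarrow> 'a \<Rightarrow> 'a set set" where
  "rooted_trees T x =
     {\<tau>. (\<exists>n. \<tau> \<subseteq> (\<Union>i\<le>n. (T ^^ i) -` {x})) \<and> x \<in> \<tau> \<and> (\<forall>y\<in>\<tau>. y \<noteq> x \<longrightarrow> T y \<in> \<tau>)}"

text \<open>
  The average over \<open>J\<close>, with the sums normalised at the point \<open>x\<close>; by the cocycle identity the
  value does not depend on the choice of \<open>x\<close> in the class containing \<open>J\<close>.
\<close>

definition weighted_avg ::
    "('a \<Rightarrow> 'a \<Rightarrow> real) \<Rightarrow> ('a \<Rightarrow> real) \<Rightarrow> 'a \<Rightarrow> 'a set \<Rightarrow> real" where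
  "weighted_avg \<rho> f x J = (\<Sum>\<^sub>\<infinity>y\<in>J. f y * \<rho> x y) / (\<Sum>\<^sub>\<infinity>y\<in>J. \<rho> x y)"

definition max_fun ::
    "('a \<Rightarrow> 'a) \<Rightarrow> ('a \<Rightarrow> 'a \<Rightarrow> real) \<Rightarrow> ('a \<Rightarrow> real) \<Rightarrow> 'a \<Rightarrow> ereal" where
  "max_fun T \<rho> f x = (SUP \<tau>\<in>rooted_trees T x. ereal (weighted_avg \<rho> f x \<tau>))"

end

theory Submission
  imports Defs
begin

text \<open>
  The maximal inequality is a Hopf-type argument for the transfer operator
  \<open>L h x = (\<Sum>\<^sub>\<infinity>y\<in>T -` {x}. \<rho> x y * h y)\<close>.  Put \<open>g = f - c\<close>.  A tree at \<open>x\<close> has average greater than \<open>c\<close>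
  exactly when its weighted sum of \<open>g\<close> is positive.  The largest such sum over trees of height at most \<open>n\<close>
  obeys a recursion, \<open>F\<^sub>0 = g\<close> and \<open>F\<^sub>n\<^sub>+\<^sub>1 = g + L (F\<^sub>n\<^sup>+)\<close>: a tree consists of its root and of trees at
  some of the preimages of the root, and it is best to keep just those preimages at which a positive sum can
  be reached (\<open>tree_sum_le_max\<close>, \<open>max_tree_sum_attained\<close>).  On \<open>{F\<^sub>n\<^sub>+\<^sub>1 > 0}\<close> one has
  \<open>g = F\<^sub>n\<^sub>+\<^sub>1\<^sup>+ - L (F\<^sub>n\<^sup>+)\<close>, and off this set the right-hand side is at most \<open>0\<close>.  Since \<open>L\<close> preserves
  integrals of nonnegative functions (\<open>transfer_integrable\<close>) and \<open>F\<^sub>n \<le> F\<^sub>n\<^sub>+\<^sub>1\<close>, the integral of \<open>g\<close> over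
  \<open>{F\<^sub>n\<^sub>+\<^sub>1 > 0}\<close> is at least \<open>\<integral> F\<^sub>n\<^sub>+\<^sub>1\<^sup>+ - \<integral> F\<^sub>n\<^sup>+ \<ge> 0\<close>.  These sets increase to
  \<open>{f\<^sup>* > c}\<close> up to a null set.  Finiteness of \<open>f\<^sup>*\<close> follows because \<open>n \<mu>{f\<^sup>* = \<infinity>} \<le> \<integral> \<bar>f\<bar>\<close> for every \<open>n\<close>.

  The measure theory lies in the claim about \<open>L\<close>.  The cocycle is tied to the measure only through Borel
  injections, so \<open>X\<close> has to be cut into countably many Borel pieces on which \<open>T\<close> is injective.  Moreover
  the part left over must be negligible for all backward trees: its image under \<open>T\<close>, not only the part itself, must be
  null.  Both come from one selection principle (\<open>injective_compact_subset\<close>): a Borel set whose image is not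
  null contains a compact set on which \<open>T\<close> is injective and whose image is not null.  Null preservation
  then makes this compact set nonnull, so a family of pieces of maximal measure leaves over a set with null
  image (\<open>exists_injectivity_pieces\<close>).  The selection principle itself writes the graph of \<open>T\<close> over the
  Borel set as a projection of a closed set, replaces the closed set by a compact one (capacitability), and
  then shrinks the compact set until the projection to the image is injective.
\<close>

section \<open>Borel sets as projections of closed sets\<close>

text \<open>
  The analytic (Suslin) sets, with the Baire space \<open>\<nat> \<rightarrow> \<nat>\<close> as parameter space.  The type \<open>discrete\<close>
  supplies the metric for which the parameter space is complete and separable.
\<close>
definition analytic_set :: "'a::metric_space set \<Rightarrow> bool" where
  "analytic_set B \<longleftrightarrow> (\<exists>F :: ('a \<times> (nat \<Rightarrow> nat discrete)) set. closed F \<and> B = fst ` F)"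

lemma analytic_set_closed: "closed B \<Longrightarrow> analytic_set B"
  unfolding analytic_set_def by (rule exI[of _ "B \<times> UNIV"]) (auto intro: closed_Times)

text \<open>
  The coordinate \<open>0\<close> of the parameter selects the set of the family, the remaining coordinates witness
  membership in it.
\<close>
lemma analytic_set_UN:
  fixes A :: "nat \<Rightarrow> 'a::metric_space set"
  assumes "\<And>n. analytic_set (A n)"
  shows "analytic_set (\<Union>n. A n)"
proof -
  have "\<exists>G. \<forall>n. closed (G n :: ('a \<times> (nat \<Rightarrow> nat discrete)) set) \<and> A n = fst ` G n"
    using assms unfolding analytic_set_def by metis
  then obtain G :: "nat \<Rightarrow> ('a \<times> (nat \<Rightarrow> nat discrete)) set"
    where G: "\<And>n. closed (G n)" "\<And>n. A n = fst ` G n" by blast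
  let ?\<phi> = "\<lambda>w::'a \<times> (nat \<Rightarrow> nat discrete). (fst w, \<lambda>k. snd w (Suc k))"
  define F where "F = {w. ?\<phi> w \<in> G (of_discrete (snd w 0))}"
  have coord: "continuous_on UNIV (\<lambda>w::'a \<times> (nat \<Rightarrow> nat discrete). snd w k)" for k
    by (rule continuous_on_product_then_coordinatewise) (intro continuous_intros)
  have \<phi>: "continuous_on UNIV ?\<phi>"
    by (intro continuous_on_Pair continuous_on_coordinatewise_then_product coord continuous_intros)
  have discrete: "open {n}" for n :: "nat discrete" by (rule open_discrete)
  have "open (\<Union>n. ((\<lambda>w::'a \<times> (nat \<Rightarrow> nat discrete). snd w 0) -` {discrete n}) \<inter> (?\<phi> -` (- G n)))"
    using G(1) discrete by (intro open_UN ballI open_Int open_vimage coord \<phi>) auto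
  moreover have "(\<Union>n. ((\<lambda>w::'a \<times> (nat \<Rightarrow> nat discrete). snd w 0) -` {discrete n}) \<inter> (?\<phi> -` (- G n))) = - F"
    by (auto simp: F_def discrete_inverse) (metis of_discrete_inverse)
  ultimately have "closed F" by (simp add: closed_def)
  moreover have "(\<Union>n. A n) = fst ` F"
  proof (intro equalityI subsetI)
    fix z assume "z \<in> (\<Union>n. A n)"
    then obtain n a where "(z, a) \<in> G n" using G(2) by force
    then have "(z, case_nat (discrete n) a) \<in> F" by (simp add: F_def discrete_inverse)
    then show "z \<in> fst ` F" by force
  next
    fix z assume "z \<in> fst ` F"
    then obtain a where "(z, \<lambda>k. a (Suc k)) \<in> G (of_discrete (a 0))" by (auto simp: F_def)
    then have "z \<in> A (of_discrete (a 0))" unfolding G(2) by (force simp: image_iff)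
    then show "z \<in> (\<Union>n. A n)" by blast
  qed
  ultimately show ?thesis unfolding analytic_set_def by blast
qed

text \<open>
  One parameter sequence codes countably many, through \<^const>\<open>prod_encode\<close>.
\<close>
lemma analytic_set_INT:
  fixes A :: "nat \<Rightarrow> 'a::metric_space set"
  assumes "\<And>n. analytic_set (A n)"
  shows "analytic_set (\<Inter>n. A n)"
proof -
  have "\<exists>G. \<forall>n. closed (G n :: ('a \<times> (nat \<Rightarrow> nat discrete)) set) \<and> A n = fst ` G n"
    using assms unfolding analytic_set_def by metis
  then obtain G :: "nat \<Rightarrow> ('a \<times> (nat \<Rightarrow> nat discrete)) set"
    where G: "\<And>n. closed (G n)" "\<And>n. A n = fst ` G n" by blast
  let ?\<phi> = "\<lambda>n (w::'a \<times> (nat \<Rightarrow> nat discrete)). (fst w, \<lambda>k. snd w (prod_encode (n, k)))"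
  define F where "F = (\<Inter>n. ?\<phi> n -` G n)"
  have coord: "continuous_on UNIV (\<lambda>w::'a \<times> (nat \<Rightarrow> nat discrete). snd w k)" for k
    by (rule continuous_on_product_then_coordinatewise) (intro continuous_intros)
  have \<phi>: "continuous_on UNIV (?\<phi> n)" for n
    by (intro continuous_on_Pair continuous_on_coordinatewise_then_product coord continuous_intros)
  have "closed F"
    unfolding F_def by (intro closed_INT ballI closed_vimage G(1) \<phi>)
  moreover have "(\<Inter>n. A n) = fst ` F"
  proof (intro equalityI subsetI)
    fix z assume "z \<in> (\<Inter>n. A n)"
    then have "\<forall>n. \<exists>a. (z, a) \<in> G n" using G(2) by force
    then obtain a where a: "\<And>n. (z, a n) \<in> G n" by metis
    have "(z, \<lambda>i. a (fst (prod_decode i)) (snd (prod_decode i))) \<in> F"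
      using a by (simp add: F_def)
    then show "z \<in> fst ` F" by force
  next
    fix z assume "z \<in> fst ` F"
    then obtain a where "\<And>n. (z, \<lambda>k. a (prod_encode (n, k))) \<in> G n" by (auto simp: F_def)
    then show "z \<in> (\<Inter>n. A n)" unfolding G(2) by (force simp: image_iff)
  qed
  ultimately show ?thesis unfolding analytic_set_def by blast
qed

lemma analytic_set_open:
  fixes U :: "'a::metric_space set"
  assumes "open U" shows "analytic_set U"
proof -
  have "fsigma_in euclidean U"
    using assms by (intro open_imp_fsigma_in) (auto simp: metrizable_space_euclidean)
  then obtain C where C: "\<And>n::nat. closed (C n)" "U = (\<Union>n. C n)"
    by (auto simp: fsigma_in_ascending)
  then show ?thesis
    by (metis analytic_set_UN analytic_set_closed)
qed

text \<open>
  Analytic sets are not closed under complement, so the induction over the \<open>\<sigma>\<close>-algebra carries the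
  complement along.
\<close>
lemma analytic_set_borel:
  fixes B :: "'a::metric_space set"
  assumes "B \<in> sets borel" shows "analytic_set B"
proof -
  have "B \<in> sigma_sets UNIV {S. open S}" using assms by (simp add: sets_borel)
  then have "analytic_set B \<and> analytic_set (- B)"
  proof induction
    case (Basic a) then show ?case by (auto intro: analytic_set_open analytic_set_closed)
  next
    case Empty then show ?case by (auto intro: analytic_set_closed)
  next
    case (Compl a) then show ?case by (simp add: Compl_eq_Diff_UNIV[symmetric])
  next
    case (Union a) then show ?case by (auto intro: analytic_set_UN analytic_set_INT)
  qed
  then show ?thesis ..
qed

section \<open>Selecting compact sets on which a map is injective\<close>

lemma inner_regular_measure:
  fixes M :: "'a::polish_space measure"
  assumes "finite_measure M" "sets M = sets borel" "D \<in> sets M" "0 < e"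
  obtains L where "compact L" "L \<subseteq> D" "measure M D - e < measure M L"
proof -
  interpret finite_measure M by fact
  show thesis
  proof (cases "e \<le> measure M D")
    case True
    then have "ennreal (measure M D - e) < emeasure M D"
      using assms(4) by (simp add: emeasure_eq_measure ennreal_less_iff)
    also have "emeasure M D = (SUP K \<in> {K. K \<subseteq> D \<and> compact K}. emeasure M K)"
      using assms by (intro inner_regular) auto
    finally obtain L where "L \<subseteq> D" "compact L" "ennreal (measure M D - e) < emeasure M L"
      by (auto simp: less_SUP_iff)
    then show thesis using True that[of L] by (auto simp: emeasure_eq_measure ennreal_less_iff)
  next
    case False
    then show thesis using that[of "{}"] by auto
  qed
qed

text \<open>
  Points of \<open>G n\<close> outside \<open>U\<close>, one for each \<open>n\<close>, would form a totally bounded sequence, and its cluster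
  points lie in every \<open>G n\<close> but not in \<open>U\<close>.
\<close>
lemma totally_bounded_nest_absorbed:
  fixes G :: "nat \<Rightarrow> 'w::complete_space set"
  assumes cl: "\<And>n. closed (G n)" and dec: "\<And>m n. m \<le> n \<Longrightarrow> G n \<subseteq> G m"
    and tb: "\<And>e. 0 < e \<Longrightarrow> \<exists>n k. finite k \<and> G n \<subseteq> (\<Union>x\<in>k. cball x e)"
    and U: "open U" "(\<Inter>n. G n) \<subseteq> U"
  shows "\<exists>n. G n \<subseteq> U"
proof (rule ccontr)
  assume "\<nexists>n. G n \<subseteq> U"
  then have "\<forall>n. \<exists>w. w \<in> G n \<and> w \<notin> U" by blast
  then obtain w where w: "\<And>n. w n \<in> G n" "\<And>n. w n \<notin> U" by metis
  let ?L = "closure (range w)"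
  have "compact ?L"
    unfolding compact_eq_totally_bounded
  proof (intro conjI allI impI)
    show "Topological_Spaces.complete ?L" by (simp add: complete_eq_closed)
    fix e :: real assume "0 < e"
    then obtain n k where k: "finite k" "G n \<subseteq> (\<Union>x\<in>k. cball x (e/2))" using tb[of "e/2"] by auto
    let ?k = "k \<union> w ` {..<n}"
    have "w i \<in> (\<Union>x\<in>?k. cball x (e/2))" for i
    proof (cases "i < n")
      case True then show ?thesis using \<open>0 < e\<close> by force
    next
      case False
      then have "w i \<in> G n" using w(1)[of i] dec[of n i] by auto
      then show ?thesis using k(2) by blast
    qed
    then have "range w \<subseteq> (\<Union>x\<in>?k. cball x (e/2))" by blast
    moreover have "closed (\<Union>x\<in>?k. cball x (e/2))" using k(1) by (intro closed_UN) auto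
    ultimately have "?L \<subseteq> (\<Union>x\<in>?k. cball x (e/2))" by (rule closure_minimal)
    also have "\<dots> \<subseteq> (\<Union>x\<in>?k. ball x e)" using \<open>0 < e\<close> by force
    finally show "\<exists>k. finite k \<and> ?L \<subseteq> (\<Union>x\<in>k. ball x e)" using k(1) by (intro exI[of _ ?k]) auto
  qed
  then have "seq_compact ?L" by (simp add: compact_eq_seq_compact_metric)
  moreover have "\<forall>n. w n \<in> ?L" using closure_subset[of "range w"] by blast
  ultimately obtain l r where r: "strict_mono (r :: nat \<Rightarrow> nat)" "(w \<circ> r) \<longlonglongrightarrow> l"
    unfolding seq_compact_def by blast
  have "l \<in> G n" for n
  proof (rule Lim_in_closed_set[OF cl _ _ r(2)])
    show "eventually (\<lambda>i. (w \<circ> r) i \<in> G n) sequentially"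
      using eventually_ge_at_top[of n]
    proof eventually_elim
      case (elim i)
      then have "n \<le> r i" using seq_suble[OF r(1), of i] by simp
      then show ?case using w(1) dec by fastforce
    qed
  qed simp
  then have "l \<in> U" using U by blast
  moreover have "l \<in> - U"
    by (rule Lim_in_closed_set[OF _ _ _ r(2)]) (use U w in auto)
  ultimately show False by blast
qed

text \<open>
  Capacitability of continuous images of closed sets.  Outer measure is continuous along increasing unions
  of arbitrary sets, so for each \<open>n\<close> finitely many balls of radius \<open>1 / (n + 1)\<close> suffice to keep the outer measure
  of the image above \<open>e\<close>.  The intersection of all these restrictions is totally bounded, hence compact,
  and by absorption its image is not smaller.
\<close>
lemma compact_approx_image:
  fixes p :: "'w::{complete_space, second_countable_topology} \<Rightarrow> 'a::polish_space"
  assumes M: "finite_measure M" "sets M = sets borel"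
    and F: "closed F" and p: "continuous_on UNIV p" and e: "e < outer_measure_of M (p ` F)"
  obtains K where "compact K" "K \<subseteq> F" "e \<le> emeasure M (p ` K)"
proof -
  interpret finite_measure M by fact
  have sp: "space M = UNIV" using sets_eq_imp_space_eq[OF M(2)] by simp
  obtain D :: "'w set" where D: "countable D" "\<And>X. open X \<Longrightarrow> X \<noteq> {} \<Longrightarrow> \<exists>d\<in>D. d \<in> X"
    using countable_dense_exists by blast
  have "D \<noteq> {}" using D(2)[of UNIV] by auto
  define C where "C n m = (\<Union>i\<le>m. cball (from_nat_into D i) (1 / Suc n))" for n m
  have closedC: "closed (C n m)" for n m unfolding C_def by (intro closed_UN) auto
  have cover: "(\<Union>m. C n m) = UNIV" for n
  proof -
    have "\<exists>m. x \<in> C n m" for x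
    proof -
      obtain d where "d \<in> D" "d \<in> ball x (1 / Suc n)" using D(2)[of "ball x (1 / Suc n)"] by force
      then obtain i where "d = from_nat_into D i" using D(1) from_nat_into_surj by metis
      then have "x \<in> C n i" using \<open>d \<in> ball x _\<close> unfolding C_def by (auto simp: dist_commute less_imp_le intro!: bexI[of _ i])
      then show ?thesis by blast
    qed
    then show ?thesis by blast
  qed
  define P where "P S \<longleftrightarrow> closed S \<and> S \<subseteq> F \<and> e < outer_measure_of M (p ` S)" for S
  have "\<exists>S'. P S' \<and> (\<exists>m. S' = S \<inter> C n m)" if "P S" for S n
  proof -
    have "(SUP m. outer_measure_of M (p ` (S \<inter> C n m))) = outer_measure_of M (\<Union>m. p ` (S \<inter> C n m))"
    proof (rule SUP_outer_measure_of_incseq)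
      have "C n m \<subseteq> C n m'" if "m \<le> m'" for m m' using that unfolding C_def by (intro UN_mono) auto
      then show "incseq (\<lambda>m. p ` (S \<inter> C n m))" unfolding incseq_def by blast
    qed (simp add: sp)
    also have "(\<Union>m. p ` (S \<inter> C n m)) = p ` S" using cover[of n] by blast
    finally have "e < (SUP m. outer_measure_of M (p ` (S \<inter> C n m)))" using that by (simp add: P_def)
    then obtain m where "e < outer_measure_of M (p ` (S \<inter> C n m))" by (auto simp: less_SUP_iff)
    then have "P (S \<inter> C n m)" using that closedC unfolding P_def by auto
    then show ?thesis by blast
  qed
  moreover have "P F" using assms by (simp add: P_def)
  ultimately obtain G where G: "\<And>n. P (G n)" "\<And>n. \<exists>m. G (Suc n) = G n \<inter> C n m"
    using dependent_nat_choice[of "\<lambda>_. P" "\<lambda>n S S'. \<exists>m. S' = S \<inter> C n m"] by metis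
  have dec: "G n \<subseteq> G m" if "m \<le> n" for m n
    by (rule lift_Suc_antimono_le[OF _ that]) (use G(2) in blast)
  have tb: "\<exists>n k. finite k \<and> G n \<subseteq> (\<Union>x\<in>k. cball x r)" if r: "0 < r" for r
  proof -
    obtain n where n: "1 / Suc n < r" using r nat_approx_posE by blast
    obtain m where "G (Suc n) \<subseteq> C n m" using G(2) by blast
    also have "\<dots> \<subseteq> (\<Union>x\<in>from_nat_into D ` {..m}. cball x r)"
      unfolding C_def UN_simps using n by (intro UN_mono subset_cball) auto
    finally show ?thesis by (intro exI[of _ "Suc n"] exI[of _ "from_nat_into D ` {..m}"]) auto
  qed
  define K where "K = (\<Inter>n. G n)"
  have "compact K" unfolding compact_eq_totally_bounded
  proof (intro conjI allI impI)
    show "Topological_Spaces.complete K" unfolding K_def complete_eq_closed using G(1) by (auto simp: P_def)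
    fix r :: real assume "0 < r"
    then obtain n k where "finite k" "G n \<subseteq> (\<Union>x\<in>k. cball x (r/2))" using tb[of "r/2"] by auto
    moreover have "(\<Union>x\<in>k. cball x (r/2)) \<subseteq> (\<Union>x\<in>k. ball x r)" using \<open>0 < r\<close> by force
    ultimately show "\<exists>k. finite k \<and> K \<subseteq> (\<Union>x\<in>k. ball x r)" unfolding K_def by blast
  qed
  moreover have "K \<subseteq> F" using G(1) unfolding K_def P_def by blast
  moreover have "e \<le> emeasure M (p ` K)"
  proof -
    have "compact (p ` K)" using \<open>compact K\<close> p by (meson compact_continuous_image continuous_on_subset top_greatest)
    then have "p ` K \<in> sets borel" by (simp add: borel_compact)
    then have "emeasure M (p ` K) = (INF U \<in> {U. p ` K \<subseteq> U \<and> open U}. emeasure M U)"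
      using M by (intro outer_regular) auto
    also have "e \<le> \<dots>"
    proof (intro INF_greatest, clarify)
      fix U assume U: "p ` K \<subseteq> U" "open U"
      then have "open (p -` U)" "(\<Inter>n. G n) \<subseteq> p -` U" using p by (auto simp: K_def intro: open_vimage)
      then obtain n where "G n \<subseteq> p -` U"
        using totally_bounded_nest_absorbed[of G "p -` U"] dec tb G(1) unfolding P_def by blast
      then have "outer_measure_of M (p ` G n) \<le> outer_measure_of M U" by (intro outer_measure_of_mono) auto
      moreover have "e < outer_measure_of M (p ` G n)" using G(1) by (simp add: P_def)
      moreover have "U \<in> sets M" using U M by simp
      ultimately show "e \<le> emeasure M U" by simp
    qed
    finally show ?thesis .
  qed
  ultimately show thesis by (rule that)
qed

text \<open>
  Cover \<open>S\<close> by finitely many compact pieces of diameter at most \<open>r\<close>, make their images disjoint, and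
  keep in each piece only the points over a compact part of its share of the image.  Two points in the same
  fibre then come from the same piece.
\<close>
lemma shrink_fibres:
  fixes p :: "'w::metric_space \<Rightarrow> 'a::polish_space"
  assumes M: "finite_measure M" "sets M = sets borel"
    and S: "compact S" and p: "continuous_on UNIV p" and e: "e < measure M (p ` S)" and r: "0 < r"
  obtains S' where "compact S'" "S' \<subseteq> S" "e < measure M (p ` S')"
    "\<And>x y. x \<in> S' \<Longrightarrow> y \<in> S' \<Longrightarrow> p x = p y \<Longrightarrow> dist x y \<le> r"
proof -
  interpret finite_measure M by fact
  obtain k where k: "finite k" "S \<subseteq> (\<Union>x\<in>k. ball x (r/2))"
    using S r unfolding compact_eq_totally_bounded by (meson half_gt_zero)
  obtain c where c: "k = c ` {..<card k}" using k(1) ex_bij_betw_nat_finite[of k]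
    by (auto simp: bij_betw_def lessThan_atLeast0)
  define N where "N = card k"
  define P where "P i = S \<inter> cball (c i) (r/2)" for i
  have P: "compact (P i)" for i unfolding P_def using S by (simp add: compact_Int_closed)
  have pP: "compact (p ` P i)" for i using P p by (meson compact_continuous_image continuous_on_subset top_greatest)
  have SP: "S = (\<Union>i<N. P i)"
  proof
    show "S \<subseteq> (\<Union>i<N. P i)"
    proof
      fix x assume "x \<in> S"
      then obtain z where z: "z \<in> k" "x \<in> ball z (r/2)" using k(2) by blast
      from z(1) c obtain i where "i < N" "z = c i" unfolding N_def by blast
      with z(2) have "i < N" "dist (c i) x < r/2" by auto
      then show "x \<in> (\<Union>i<N. P i)" using \<open>x \<in> S\<close> unfolding P_def by (auto intro!: bexI[of _ i])
    qed
  qed (auto simp: P_def)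
  define D where "D i = p ` P i - (\<Union>j<i. p ` P j)" for i
  have D: "D i \<in> sets M" for i unfolding D_def M(2) using pP by (auto intro: borel_compact)
  have disD: "disjoint_family D" unfolding disjoint_family_on_def
  proof (intro ballI impI)
    fix m n :: nat assume "m \<noteq> n"
    then have "m < n \<or> n < m" by auto
    then show "D m \<inter> D n = {}" unfolding D_def by blast
  qed
  have UD: "p ` S = (\<Union>i<N. D i)"
  proof
    show "p ` S \<subseteq> (\<Union>i<N. D i)"
    proof
      fix y assume "y \<in> p ` S"
      then have ex: "\<exists>i. i < N \<and> y \<in> p ` P i" unfolding SP by auto
      define i where "i = (LEAST i. i < N \<and> y \<in> p ` P i)"
      have "i < N \<and> y \<in> p ` P i" unfolding i_def using ex by (rule LeastI_ex)
      moreover have "y \<notin> p ` P j" if "j < i" for j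
        using not_less_Least[of j "\<lambda>i. i < N \<and> y \<in> p ` P i"] that calculation unfolding i_def by auto
      ultimately show "y \<in> (\<Union>i<N. D i)" unfolding D_def by blast
    qed
    show "(\<Union>i<N. D i) \<subseteq> p ` S" unfolding D_def SP by blast
  qed
  \<comment> \<open>Each of the \<open>N\<close> pieces may lose less than \<open>d\<close> of its image; the denominator \<open>N + 1\<close> makes the total
    loss smaller than the excess over \<open>e\<close>, also for \<open>N = 0\<close>.\<close>
  define d where "d = (measure M (p ` S) - e) / (N + 1)"
  have "0 < d" using e by (simp add: d_def)
  have "\<forall>i. \<exists>L. compact L \<and> L \<subseteq> D i \<and> measure M (D i) - d < measure M L"
    using inner_regular_measure[OF M D \<open>0 < d\<close>] by metis
  then obtain L where L: "\<And>i. compact (L i)" "\<And>i. L i \<subseteq> D i" "\<And>i. measure M (D i) - d < measure M (L i)"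
    by metis
  define S' where "S' = (\<Union>i<N. P i \<inter> p -` L i)"
  have "compact S'" unfolding S'_def
    using P p L(1) by (intro compact_UN compact_Int_closed closed_vimage) (auto intro: compact_imp_closed)
  moreover have "S' \<subseteq> S" unfolding S'_def SP by blast
  moreover have "e < measure M (p ` S')"
  proof -
    have "p ` (P i \<inter> p -` L i) = L i" for i using L(2)[of i] unfolding D_def by blast
    then have "p ` S' = (\<Union>i<N. L i)" unfolding S'_def by (simp add: image_UN)
    moreover have "measure M (\<Union>i<N. L i) = (\<Sum>i<N. measure M (L i))"
    proof (rule finite_measure_finite_Union)
      show "disjoint_family_on L {..<N}"
        using disD L(2) unfolding disjoint_family_on_def by blast
    qed (use L(1) M(2) in \<open>auto intro: borel_compact\<close>)
    moreover have "measure M (p ` S) = (\<Sum>i<N. measure M (D i))"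
      unfolding UD using D disD by (intro finite_measure_finite_Union) (auto simp: disjoint_family_on_def)
    moreover have "(\<Sum>i<N. measure M (D i) - d) \<le> (\<Sum>i<N. measure M (L i))"
      using L(3) by (intro sum_mono less_imp_le)
    moreover have "(\<Sum>i<N. measure M (D i) - d) = (\<Sum>i<N. measure M (D i)) - N * d" by (simp add: sum_subtractf)
    moreover have "N * d < measure M (p ` S) - e"
      using e by (simp add: d_def field_simps)
    ultimately show ?thesis by simp
  qed
  moreover have "dist x y \<le> r" if xy: "x \<in> S'" "y \<in> S'" "p x = p y" for x y
  proof -
    obtain i j where ij: "x \<in> P i" "p x \<in> L i" "y \<in> P j" "p y \<in> L j" using xy(1,2) unfolding S'_def by blast
    have "p x \<in> D i \<inter> D j" using ij L(2) xy(3) by auto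
    then have "i = j" using disD unfolding disjoint_family_on_def by blast
    then have "dist (c i) x \<le> r/2" "dist (c i) y \<le> r/2" using ij by (auto simp: P_def)
    then show ?thesis by (smt (verit, best) dist_commute dist_triangle field_sum_of_halves)
  qed
  ultimately show thesis by (rule that)
qed

text \<open>
  Repeated shrinking forces the fibres of the intersection to be single points.  No measure is lost in the
  limit, because the image of a decreasing intersection of compact sets is the intersection of their images.
\<close>
lemma compact_uniformization:
  fixes p :: "'w::metric_space \<Rightarrow> 'a::polish_space"
  assumes M: "finite_measure M" "sets M = sets borel"
    and S: "compact S" and p: "continuous_on UNIV p" and e: "e < measure M (p ` S)"
  obtains K where "compact K" "K \<subseteq> S" "e \<le> measure M (p ` K)" "inj_on p K"
proof -
  interpret finite_measure M by fact
  define P where "P A \<longleftrightarrow> compact A \<and> A \<subseteq> S \<and> e < measure M (p ` A)" for A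
  define Q where "Q n A A' \<longleftrightarrow> A' \<subseteq> A \<and> (\<forall>x\<in>A'. \<forall>y\<in>A'. p x = p y \<longrightarrow> dist x y \<le> 1 / Suc n)" for n :: nat and A A'
  have "\<exists>A'. P A' \<and> Q n A A'" if "P A" for A n
  proof -
    have "(0::real) < 1 / Suc n" by simp
    from that shrink_fibres[OF M _ p _ this, of A e] obtain A' where
      "compact A'" "A' \<subseteq> A" "e < measure M (p ` A')"
      "\<And>x y. x \<in> A' \<Longrightarrow> y \<in> A' \<Longrightarrow> p x = p y \<Longrightarrow> dist x y \<le> 1 / Suc n" unfolding P_def by metis
    then show ?thesis using that unfolding P_def Q_def by (intro exI[of _ A']) auto
  qed
  moreover have "P S" using S e by (simp add: P_def)
  ultimately obtain G where G: "\<And>n. P (G n)" "\<And>n. Q n (G n) (G (Suc n))"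
    using dependent_nat_choice[of "\<lambda>_. P" Q] by metis
  have dec: "G n \<subseteq> G m" if "m \<le> n" for m n
    by (rule lift_Suc_antimono_le[OF _ that]) (use G(2) in \<open>auto simp: Q_def\<close>)
  have comp: "compact (G n)" for n using G(1) by (simp add: P_def)
  define K where "K = (\<Inter>n. G n)"
  have "K = G 0 \<inter> K" by (auto simp: K_def)
  moreover have "closed K" unfolding K_def using comp by (auto intro: compact_imp_closed)
  ultimately have "compact K" using comp compact_Int_closed by metis
  moreover have "K \<subseteq> S" using G(1) unfolding K_def P_def by blast
  moreover have "inj_on p K"
  proof
    fix x y assume xy: "x \<in> K" "y \<in> K" "p x = p y"
    have le: "dist x y \<le> 1 / Suc n" for n
      using xy G(2)[of n] unfolding K_def Q_def by blast
    show "x = y"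
    proof (rule ccontr)
      assume "x \<noteq> y"
      then have "0 < dist x y" by simp
      then obtain n where "1 / Suc n < dist x y" using nat_approx_posE by blast
      with le[of n] show False by simp
    qed
  qed
  moreover have "e \<le> measure M (p ` K)"
  proof -
    have "p ` K = (\<Inter>n. p ` G n)"
    proof
      show "(\<Inter>n. p ` G n) \<subseteq> p ` K"
      proof
        fix y assume y: "y \<in> (\<Inter>n. p ` G n)"
        have cl: "closed (G n \<inter> p -` {y})" for n using comp p by (intro closed_Int closed_vimage compact_imp_closed) auto
        have "G 0 \<inter> \<Inter>(range (\<lambda>n. G n \<inter> p -` {y})) \<noteq> {}"
        proof (rule compact_imp_fip[OF comp])
          fix F' assume F': "finite F'" "F' \<subseteq> range (\<lambda>n. G n \<inter> p -` {y})"
          then obtain I where I: "finite I" "F' = (\<lambda>n. G n \<inter> p -` {y}) ` I" by (meson finite_subset_image)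
          define m where "m = Max (insert 0 I)"
          obtain x where "x \<in> G m" "p x = y" using y by auto
          moreover have "n \<le> m" if "n \<in> I" for n using that I by (simp add: m_def)
          ultimately have "x \<in> G 0 \<inter> \<Inter>F'" using dec unfolding I(2) by blast
          then show "G 0 \<inter> \<Inter>F' \<noteq> {}" by blast
        qed (use cl in auto)
        then obtain x where "\<And>n. x \<in> G n \<and> p x = y" by blast
        then show "y \<in> p ` K" unfolding K_def by blast
      qed
    qed (auto simp: K_def)
    moreover have "(\<lambda>n. measure M (p ` G n)) \<longlonglongrightarrow> measure M (\<Inter>n. p ` G n)"
    proof (rule finite_Lim_measure_decseq)
      have "compact (p ` G n)" for n
        using comp p by (meson compact_continuous_image continuous_on_subset top_greatest)
      then show "range (\<lambda>n. p ` G n) \<subseteq> sets M" using M(2) by (auto intro: borel_compact)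
      show "decseq (\<lambda>n. p ` G n)" using dec by (auto simp: decseq_def intro!: image_mono)
    qed
    moreover have "e \<le> measure M (p ` G n)" for n using G(1) by (simp add: P_def less_imp_le)
    ultimately show ?thesis by (metis LIMSEQ_le_const)
  qed
  ultimately show thesis using that by blast
qed

text \<open>
  A measure-theoretic form of the Jankov--von Neumann selection theorem.  Uniformizing the map \<open>p\<close> to
  the second coordinate over the closed set \<open>F\<close> above the graph, and then projecting by \<open>q\<close> to the domain of \<open>T\<close>,
  yields a compact set, in particular a Borel one.
\<close>
lemma injective_compact_subset:
  fixes T :: "'b::polish_space \<Rightarrow> 'a::polish_space"
  assumes M: "finite_measure M" "sets M = sets borel"
    and T: "T \<in> borel_measurable borel" and B: "B \<in> sets borel"
    and pos: "T ` B \<notin> null_sets (completion M)"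
  obtains C where "compact C" "C \<subseteq> B" "inj_on T C" "T ` C \<notin> null_sets M"
proof -
  interpret finite_measure M by fact
  have sp: "space M = UNIV" using sets_eq_imp_space_eq[OF M(2)] by simp
  define \<Gamma> where "\<Gamma> = {w :: 'b \<times> 'a. fst w \<in> B \<and> T (fst w) = snd w}"
  have m1: "fst \<in> borel_measurable (borel :: ('b \<times> 'a) measure)"
    and m2: "snd \<in> borel_measurable (borel :: ('b \<times> 'a) measure)"
    by (auto intro!: borel_measurable_continuous_onI continuous_intros)
  have "(fst -` B \<inter> space (borel :: ('b \<times> 'a) measure)) \<in> sets borel" using m1 B by (rule measurable_sets)
  moreover have "{w \<in> space (borel :: ('b \<times> 'a) measure). T (fst w) = snd w} \<in> sets borel"
    using m2 measurable_compose[OF m1 T] by (intro measurable_equality_set)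
  moreover have "\<Gamma> = (fst -` B \<inter> space borel) \<inter> {w \<in> space borel. T (fst w) = snd w}" by (auto simp: \<Gamma>_def)
  ultimately have "\<Gamma> \<in> sets borel" by (simp only: sets.Int)
  then have "analytic_set \<Gamma>" by (rule analytic_set_borel)
  then obtain F :: "(('b \<times> 'a) \<times> (nat \<Rightarrow> nat discrete)) set" where F: "closed F" "\<Gamma> = fst ` F"
    unfolding analytic_set_def by blast
  define p :: "('b \<times> 'a) \<times> (nat \<Rightarrow> nat discrete) \<Rightarrow> 'a" where "p = (\<lambda>w. snd (fst w))"
  define q :: "('b \<times> 'a) \<times> (nat \<Rightarrow> nat discrete) \<Rightarrow> 'b" where "q = (\<lambda>w. fst (fst w))"
  have p: "continuous_on UNIV p" and q: "continuous_on A q" for A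
    unfolding p_def q_def by (intro continuous_intros)+
  have qp: "q w \<in> B \<and> T (q w) = p w" if "w \<in> F" for w
    using that F(2) unfolding \<Gamma>_def p_def q_def by blast
  have "p ` F = snd ` \<Gamma>" unfolding F(2) p_def by (simp add: image_image)
  also have "\<dots> = T ` B"
  proof (intro equalityI subsetI)
    fix y assume "y \<in> T ` B"
    then obtain x where "x \<in> B" "y = T x" by blast
    then show "y \<in> snd ` \<Gamma>" by (intro image_eqI[of _ _ "(x, y)"]) (auto simp: \<Gamma>_def)
  qed (auto simp: \<Gamma>_def)
  finally have pF: "p ` F = T ` B" .
  have "0 < outer_measure_of M (p ` F)"
  proof (rule ccontr)
    assume "\<not> 0 < outer_measure_of M (p ` F)"
    moreover obtain E where "E \<in> sets M" "p ` F \<subseteq> E" "outer_measure_of M (p ` F) = emeasure M E"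
      using outer_measure_of_attain[of "p ` F" M] sp by auto
    ultimately have "E \<in> null_sets M" "T ` B \<subseteq> E" using pF by auto
    then show False using pos null_sets_completion_iff2 by blast
  qed
  then obtain e where e: "0 < e" "e < outer_measure_of M (p ` F)" using dense by blast
  obtain K where K: "compact K" "K \<subseteq> F" "e \<le> emeasure M (p ` K)"
    by (rule compact_approx_image[OF M F(1) p e(2)])
  have "0 < measure M (p ` K)"
    using K(3) e(1) by (metis emeasure_eq_measure ennreal_0 not_le zero_less_measure_iff measure_nonneg order.strict_iff_order)
  then obtain e' where e': "0 < e'" "e' < measure M (p ` K)" using dense by blast
  obtain K' where K': "compact K'" "K' \<subseteq> K" "e' \<le> measure M (p ` K')" "inj_on p K'"
    by (rule compact_uniformization[OF M K(1) p e'(2)])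
  have TqK: "T (q w) = p w" if "w \<in> K'" for w using that qp K(2) K'(2) by blast
  show thesis
  proof
    show "compact (q ` K')" by (rule compact_continuous_image[OF q K'(1)])
    show "q ` K' \<subseteq> B" using qp K(2) K'(2) by blast
    show "inj_on T (q ` K')"
      using K'(4) TqK unfolding inj_on_def by auto
    have "T ` q ` K' = p ` K'" using TqK by force
    then show "T ` q ` K' \<notin> null_sets M" using K'(3) e'(1)
      by (auto simp: null_sets_def emeasure_eq_measure)
  qed
qed

section \<open>Countable decomposition into injectivity pieces\<close>

locale nonsingular_cocycle_system =
  fixes M :: "'a::polish_space measure" and T :: "'a \<Rightarrow> 'a" and \<rho> :: "'a \<Rightarrow> 'a \<Rightarrow> real"
  assumes prob: "prob_space M" and sets_M: "sets M = sets borel"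
    and preserving: "measure_preserving M T"
    and null_pres: "null_preserving M (orbit_eqrel T)"
    and cocycle: "RN_cocycle M (orbit_eqrel T) \<rho>"
begin

sublocale prob_space M by (rule prob)

lemma space_M [simp]: "space M = UNIV"
  using sets_eq_imp_space_eq[OF sets_M] by simp

lemma measurable_T [measurable]: "T \<in> measurable M M"
  using preserving by (simp add: measure_preserving_def)

lemma emeasure_vimage: "A \<in> sets M \<Longrightarrow> emeasure M (T -` A) = emeasure M A"
  using preserving emeasure_distr[OF measurable_T, of A] by (simp add: measure_preserving_def)

lemma orbit_eqrel_step: "T y = x \<Longrightarrow> (x, y) \<in> orbit_eqrel T" "T y = x \<Longrightarrow> (y, x) \<in> orbit_eqrel T"
proof -
  assume "T y = x"
  then have "(T ^^ 0) x = (T ^^ 1) y" "(T ^^ 1) y = (T ^^ 0) x" by auto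
  then show "(x, y) \<in> orbit_eqrel T" "(y, x) \<in> orbit_eqrel T"
    unfolding orbit_eqrel_def by blast+
qed

lemma \<rho>_pos: "(x, y) \<in> orbit_eqrel T \<Longrightarrow> 0 < \<rho> x y"
  using cocycle by (auto simp: RN_cocycle_def)

lemma change_of_variables:
  fixes h :: "'a \<Rightarrow> real"
  assumes "partial_borel_injection M (orbit_eqrel T) A g" "integrable M h"
  shows "set_integrable M A (\<lambda>x. h (g x) * \<rho> x (g x))"
    and "(LINT y:g ` A|M. h y) = (LINT x:A|M. h (g x) * \<rho> x (g x))"
  using cocycle assms by (auto simp: RN_cocycle_def)

text \<open>
  The change-of-variables formula contains the Lusin--Souslin theorem for the injections in question: the
  integral of the indicator of a nonmeasurable image is \<open>0\<close> by convention, whereas the other side of the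
  formula integrates a positive function over \<open>A\<close>.  Hence \<open>A\<close> is null, and then so is its image.
\<close>
lemma image_in_sets:
  assumes g: "partial_borel_injection M (orbit_eqrel T) A g"
  shows "g ` A \<in> sets M"
proof (rule ccontr)
  assume not_sets: "g ` A \<notin> sets M"
  have A: "A \<in> sets M" and E: "\<And>x. x \<in> A \<Longrightarrow> (x, g x) \<in> orbit_eqrel T"
    using g by (auto simp: partial_borel_injection_def)
  have "\<not> integrable M (\<lambda>y. indicator (g ` A) y *\<^sub>R (1::real))"
  proof
    assume "integrable M (\<lambda>y. indicator (g ` A) y *\<^sub>R (1::real))"
    then have "(\<lambda>y. indicator (g ` A) y :: real) \<in> borel_measurable M" by simp
    then show False using not_sets by (simp add: borel_measurable_indicator_iff)
  qed
  then have "(LINT y:g ` A|M. 1) = (0::real)"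
    unfolding set_lebesgue_integral_def by (rule not_integrable_integral_eq)
  then have "(LINT x:A|M. \<rho> x (g x)) = 0"
    using change_of_variables(2)[OF g, of "\<lambda>_. 1"] by simp
  moreover have "integrable M (\<lambda>x. indicator A x * \<rho> x (g x))"
    using change_of_variables(1)[OF g, of "\<lambda>_. 1"] by (simp add: set_integrable_def)
  moreover have nonneg: "0 \<le> indicator A x * \<rho> x (g x)" for x
    using E[of x] \<rho>_pos by (auto simp: indicator_def less_imp_le)
  ultimately have "AE x in M. indicator A x * \<rho> x (g x) = 0"
    by (subst integral_nonneg_eq_0_iff_AE[symmetric]) (auto simp: set_lebesgue_integral_def)
  then have "AE x in M. x \<notin> A"
  proof eventually_elim
    case (elim x) then show ?case using \<rho>_pos[OF E[of x]] by (auto simp: indicator_def)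
  qed
  then have "A \<in> null_sets M" using A by (simp add: AE_iff_null_sets)
  then have "g ` A \<in> null_sets M" using null_pres g by (auto simp: null_preserving_def)
  then show False using not_sets by blast
qed

lemma partial_borel_injection_T:
  assumes "A \<in> sets M" "inj_on T A"
  shows "partial_borel_injection M (orbit_eqrel T) A T"
  using assms orbit_eqrel_step(2) by (auto simp: partial_borel_injection_def intro: measurable_restrict_space1)

lemma T_image_in_sets: "A \<in> sets M \<Longrightarrow> inj_on T A \<Longrightarrow> T ` A \<in> sets M"
  by (intro image_in_sets partial_borel_injection_T)

lemma T_image_null_iff: "A \<in> sets M \<Longrightarrow> inj_on T A \<Longrightarrow> T ` A \<in> null_sets M \<longleftrightarrow> A \<in> null_sets M"
  using null_pres partial_borel_injection_T by (auto simp: null_preserving_def)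

text \<open>
  A Lusin--Novikov theorem modulo null sets.  Take a countable union \<open>V\<close> of Borel sets on which \<open>T\<close> is injective
  with the largest possible measure.  If the image of its complement were not null, the complement would
  contain a compact set on which \<open>T\<close> is injective with nonnull image.  That compact set is itself nonnull
  by null preservation and could be added to \<open>V\<close>.
\<close>
lemma exists_injectivity_pieces:
  "\<exists>A :: nat \<Rightarrow> 'a set. (\<forall>n. A n \<in> sets M \<and> inj_on T (A n)) \<and> disjoint_family A \<and>
     T ` (- (\<Union>n. A n)) \<in> null_sets (completion M)"
proof -
  define \<A> where "\<A> = {(\<Union>n. A n) | A :: nat \<Rightarrow> 'a set. \<forall>n. A n \<in> sets M \<and> inj_on T (A n)}"
  have \<A>_sets: "U \<in> sets M" if "U \<in> \<A>" for U using that unfolding \<A>_def by auto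
  have \<A>_UN: "(\<Union>k. U k) \<in> \<A>" if U: "\<And>k::nat. U k \<in> \<A>" for U
  proof -
    have "\<forall>k. \<exists>A :: nat \<Rightarrow> 'a set. (\<forall>n. A n \<in> sets M \<and> inj_on T (A n)) \<and> U k = (\<Union>n. A n)"
      using U unfolding \<A>_def by blast
    then obtain A where A: "\<And>k n. A k n \<in> sets M \<and> inj_on T (A k n)" "\<And>k. U k = (\<Union>n::nat. A k n)"
      by metis
    have "(\<Union>k. U k) = (\<Union>i. (\<lambda>i. A (fst (prod_decode i)) (snd (prod_decode i))) i)"
    proof (intro equalityI subsetI)
      fix x assume "x \<in> (\<Union>k. U k)"
      then obtain k n where "x \<in> A k n" unfolding A(2) by blast
      then show "x \<in> (\<Union>i. (\<lambda>i. A (fst (prod_decode i)) (snd (prod_decode i))) i)"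
        by (intro UN_I[of "prod_encode (k, n)"]) simp_all
    qed (auto simp: A(2))
    then show ?thesis unfolding \<A>_def using A(1) by blast
  qed
  define s where "s = (SUP U\<in>\<A>. emeasure M U)"
  have "{} \<in> \<A>" unfolding \<A>_def by (intro CollectI exI[of _ "\<lambda>_. {}"]) auto
  then have "\<A> \<noteq> {}" by blast
  then obtain v :: "nat \<Rightarrow> ennreal" where v: "range v \<subseteq> emeasure M ` \<A>" "s = (SUP n. v n)"
    unfolding s_def using ennreal_SUP_countable_SUP[of \<A> "emeasure M"] by auto
  then have "\<forall>n. \<exists>U. U \<in> \<A> \<and> v n = emeasure M U" by blast
  then obtain U where U: "\<And>n. U n \<in> \<A>" "\<And>n. v n = emeasure M (U n)" by metis
  define V where "V = (\<Union>n. U n)"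
  have V: "V \<in> \<A>" unfolding V_def by (rule \<A>_UN) (rule U)
  have "s \<le> emeasure M V"
    unfolding v(2) U(2) by (intro SUP_least emeasure_mono \<A>_sets V) (auto simp: V_def)
  then obtain A :: "nat \<Rightarrow> 'a set" where A: "\<And>n. A n \<in> sets M" "\<And>n. inj_on T (A n)" "V = (\<Union>n. A n)"
    using V unfolding \<A>_def mem_Collect_eq by (elim exE conjE) (rule that, auto)
  have "T ` (- V) \<in> null_sets (completion M)"
  proof (rule ccontr)
    assume "T ` (- V) \<notin> null_sets (completion M)"
    moreover have "- V \<in> sets borel" using \<A>_sets[OF V] sets_M by (metis borel_comp)
    moreover have "T \<in> borel_measurable borel"
      using measurable_T measurable_cong_sets[OF sets_M sets_M] by simp
    ultimately obtain C where C: "compact C" "C \<subseteq> - V" "inj_on T C" "T ` C \<notin> null_sets M"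
      using injective_compact_subset[OF finite_measure_axioms sets_M] by metis
    have "C \<in> sets M" using C(1) sets_M by (simp add: borel_compact)
    then have "C \<notin> null_sets M" using C T_image_null_iff by blast
    have "C \<in> \<A>" unfolding \<A>_def
      using \<open>C \<in> sets M\<close> C(3) by (intro CollectI exI[of _ "\<lambda>_. C"]) auto
    then have "(\<Union>k::nat. if k = 0 then V else C) \<in> \<A>"
      using V by (intro \<A>_UN) auto
    moreover have "(\<Union>k::nat. if k = 0 then V else C) = V \<union> C"
      by (auto split: if_splits)
    ultimately have "V \<union> C \<in> \<A>" by simp
    then have "emeasure M (V \<union> C) \<le> s" unfolding s_def by (rule SUP_upper)
    moreover have "emeasure M (V \<union> C) = emeasure M V + emeasure M C"
      using C(2) \<open>C \<in> sets M\<close> \<A>_sets[OF V] by (intro plus_emeasure[symmetric]) auto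
    ultimately have "emeasure M V + emeasure M C \<le> emeasure M V" using \<open>s \<le> emeasure M V\<close> by (metis order_trans)
    then have "measure M C \<le> 0"
      by (simp add: emeasure_eq_measure ennreal_plus[symmetric] del: ennreal_plus)
    then have "emeasure M C = 0"
      by (simp add: emeasure_eq_measure measure_le_0_iff)
    then show False using \<open>C \<notin> null_sets M\<close> \<open>C \<in> sets M\<close> by auto
  qed
  then have "T ` (- (\<Union>n. disjointed A n)) \<in> null_sets (completion M)"
    by (simp add: UN_disjointed_eq A(3))
  moreover have "disjointed A n \<in> sets M" for n
    using A(1) by (metis image_subsetI sets.range_disjointed_sets rangeI subset_iff)
  moreover have "inj_on T (disjointed A n)" for n
    using A(2) disjointed_subset by (rule inj_on_subset)
  ultimately show ?thesis
    using disjoint_family_disjointed by blast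
qed

definition piece :: "nat \<Rightarrow> 'a set" where
  "piece = (SOME A. (\<forall>n. A n \<in> sets M \<and> inj_on T (A n)) \<and> disjoint_family A \<and>
     T ` (- (\<Union>n. A n)) \<in> null_sets (completion M))"

lemma piece_in_sets [measurable]: "piece n \<in> sets M"
  and inj_on_piece: "inj_on T (piece n)"
  and disjoint_pieces: "disjoint_family piece"
  and image_off_pieces_null: "T ` (- (\<Union>n. piece n)) \<in> null_sets (completion M)"
  using someI_ex[OF exists_injectivity_pieces] unfolding piece_def[symmetric] by blast+

text \<open>
  Null preservation speaks of injections only; on the part of \<open>B\<close> outside the pieces the image is null by
  the choice of the pieces.
\<close>
lemma T_image_null:
  assumes "B \<in> null_sets M"
  shows "T ` B \<in> null_sets (completion M)"
proof -
  have "T ` (B \<inter> piece n) \<in> null_sets M" for n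
  proof -
    have "B \<inter> piece n \<in> null_sets M" using assms by (simp add: null_set_Int2)
    moreover have "inj_on T (B \<inter> piece n)" using inj_on_piece by (rule inj_on_subset) auto
    ultimately show ?thesis by (subst T_image_null_iff) auto
  qed
  then have "(\<Union>n. T ` (B \<inter> piece n)) \<in> null_sets (completion M)"
    by (intro null_sets_UN null_sets_completionI)
  then have "(\<Union>n. T ` (B \<inter> piece n)) \<union> T ` (- (\<Union>n. piece n)) \<in> null_sets (completion M)"
    using image_off_pieces_null by (rule null_sets.Un)
  moreover have "T ` B \<subseteq> (\<Union>n. T ` (B \<inter> piece n)) \<union> T ` (- (\<Union>n. piece n))" by blast
  ultimately show ?thesis by (rule null_sets_completion_subset[rotated])
qed

text \<open>
  The part left over is contained in the preimage of its own image, and \<open>T\<close> preserves the measure.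
\<close>
lemma off_pieces_null: "- (\<Union>n. piece n) \<in> null_sets M"
proof -
  obtain N where N: "N \<in> null_sets M" "T ` (- (\<Union>n. piece n)) \<subseteq> N"
    using image_off_pieces_null unfolding null_sets_completion_iff2 by (elim bexE)
  have "- (\<Union>n. piece n) \<subseteq> T -` N" using N(2) unfolding image_subset_iff_subset_vimage .
  moreover have "T -` N \<in> null_sets M"
    using N(1) emeasure_vimage[of N] measurable_sets[OF measurable_T, of N] by (auto simp: null_sets_def)
  moreover have "- (\<Union>n. piece n) \<in> sets M"
    using sets.compl_sets[of "\<Union>n. piece n" M] by (auto simp: Compl_eq_Diff_UNIV)
  ultimately show ?thesis by (meson null_sets_subset)
qed

text \<open>
  A property that holds almost everywhere holds at all points of almost every backward tree: the exceptional
  null set can be enlarged to contain its forward images, so that its complement is closed under preimages.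
\<close>
lemma AE_backward_closed:
  assumes "AE x in M. P x"
  obtains R where "R \<in> null_sets M" "- (\<Union>n. piece n) \<subseteq> R" "\<And>x. x \<in> R \<Longrightarrow> T x \<in> R" "\<And>x. x \<notin> R \<Longrightarrow> P x"
proof -
  obtain N where N: "N \<in> null_sets M" "{x. \<not> P x} \<subseteq> N"
    using assms unfolding eventually_ae_filter by auto
  have ex: "\<exists>B'. B' \<in> null_sets M \<and> T ` B \<subseteq> B'" if "B \<in> null_sets M" for B
    using T_image_null[OF that] unfolding null_sets_completion_iff2 by auto
  have base: "N \<union> - (\<Union>n. piece n) \<in> null_sets M" using N(1) off_pieces_null by (rule null_sets.Un)
  obtain R :: "nat \<Rightarrow> 'a set" where R: "\<And>n::nat. R n \<in> null_sets M" "N \<union> - (\<Union>n. piece n) = R 0" "\<And>n. T ` R n \<subseteq> R (Suc n)"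
  proof -
    define R where "R = rec_nat (N \<union> - (\<Union>n. piece n)) (\<lambda>_ B. SOME B'. B' \<in> null_sets M \<and> T ` B \<subseteq> B')"
    have step: "R (Suc n) \<in> null_sets M \<and> T ` R n \<subseteq> R (Suc n)" if "R n \<in> null_sets M" for n
      using someI_ex[OF ex[OF that]] by (simp add: R_def)
    have "R n \<in> null_sets M" for n
    proof (induction n)
      case 0 show ?case using base by (simp add: R_def)
    next
      case (Suc n) then show ?case using step by blast
    qed
    moreover have "N \<union> - (\<Union>n. piece n) = R 0" by (simp add: R_def)
    ultimately show thesis using step by (intro that[of R]) blast+
  qed
  show thesis
  proof
    show "(\<Union>n. R n) \<in> null_sets M" using R(1) by (rule null_sets_UN)
    show "- (\<Union>n. piece n) \<subseteq> (\<Union>n. R n)" using R(2) by blast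
    show "T x \<in> (\<Union>n. R n)" if "x \<in> (\<Union>n. R n)" for x using that R(3) by blast
    show "P x" if "x \<notin> (\<Union>n. R n)" for x
    proof -
      have "x \<notin> N" using that R(2) by blast
      then show ?thesis using N(2) by auto
    qed
  qed
qed

end

section \<open>The transfer operator\<close>

definition transfer :: "('a \<Rightarrow> 'a) \<Rightarrow> ('a \<Rightarrow> 'a \<Rightarrow> real) \<Rightarrow> ('a \<Rightarrow> real) \<Rightarrow> 'a \<Rightarrow> real" where
  "transfer T \<rho> h x = (\<Sum>\<^sub>\<infinity>y\<in>T -` {x}. \<rho> x y * h y)"

text \<open>
  In the completion a function need only be identified almost everywhere.  This matters for fibre sums, which
  are given by measurable series only off a null set.
\<close>
lemma borel_measurable_completion_cong_AE:
  fixes f g :: "'a \<Rightarrow> 'b::topological_space"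
  assumes g: "g \<in> borel_measurable (completion M)" and ae: "AE x in M. f x = g x"
  shows "f \<in> borel_measurable (completion M)"
proof (rule measurableI)
  fix A :: "'b set" assume "A \<in> sets borel"
  then have "g -` A \<inter> space (completion M) \<in> sets (completion M)" using g by (rule measurable_sets[rotated])
  moreover have "AE x in completion M. x \<in> g -` A \<inter> space (completion M) \<longleftrightarrow> x \<in> f -` A \<inter> space (completion M)"
    using AE_completion[OF ae] by eventually_elim auto
  ultimately show "f -` A \<inter> space (completion M) \<in> sets (completion M)"
    using complete_measure.in_sets_AE[of "completion M"] completion.complete_measure_axioms by (metis Int_lower2)
qed simp

context nonsingular_cocycle_system begin

definition branch :: "nat \<Rightarrow> 'a \<Rightarrow> 'a" where
  "branch j = inv_into (piece j) T"

lemma branch_T: "y \<in> piece j \<Longrightarrow> branch j (T y) = y"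
  unfolding branch_def by (rule inv_into_f_f[OF inj_on_piece])

lemma T_branch: "x \<in> T ` piece j \<Longrightarrow> T (branch j x) = x" "x \<in> T ` piece j \<Longrightarrow> branch j x \<in> piece j"
  unfolding branch_def by (auto simp: f_inv_into_f inv_into_into)

lemma branch_image: "branch j ` T ` piece j = piece j"
  using branch_T by force

lemma partial_borel_injection_branch:
  "partial_borel_injection M (orbit_eqrel T) (T ` piece j) (branch j)"
  unfolding partial_borel_injection_def
proof (intro conjI ballI)
  show D: "T ` piece j \<in> sets M" by (intro T_image_in_sets inj_on_piece piece_in_sets)
  show "inj_on (branch j) (T ` piece j)" using T_branch(1) by (metis inj_onI)
  show "(x, branch j x) \<in> orbit_eqrel T" if "x \<in> T ` piece j" for x
    by (rule orbit_eqrel_step(1)) (rule T_branch(1)[OF that])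
  show "branch j \<in> measurable (restrict_space M (T ` piece j)) M"
  proof (rule measurableI)
    fix B assume B: "B \<in> sets M"
    have "branch j -` B \<inter> T ` piece j = T ` (piece j \<inter> B)"
      using T_branch branch_T by force
    moreover have "T ` (piece j \<inter> B) \<in> sets M"
      using B inj_on_piece[of j] by (intro T_image_in_sets) (auto intro: inj_on_subset)
    ultimately show "branch j -` B \<inter> space (restrict_space M (T ` piece j)) \<in> sets (restrict_space M (T ` piece j))"
      using D by (auto simp: space_restrict_space sets_restrict_space_iff)
  qed auto
qed

text \<open>
  Almost every fibre of \<open>T\<close> is enumerated by the inverse branches, and so it carries sums over \<open>\<nat>\<close>.
\<close>
lemma bij_betw_branches:
  assumes "\<And>y. T y = x \<Longrightarrow> y \<in> (\<Union>n. piece n)"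
  shows "bij_betw (\<lambda>j. branch j x) {j. x \<in> T ` piece j} (T -` {x})"
  unfolding bij_betw_def
proof
  show "inj_on (\<lambda>j. branch j x) {j. x \<in> T ` piece j}"
  proof (rule inj_onI)
    fix i j assume "i \<in> {j. x \<in> T ` piece j}" "j \<in> {j. x \<in> T ` piece j}" "branch i x = branch j x"
    then have "branch i x \<in> piece i \<inter> piece j" using T_branch(2)[of x i] T_branch(2)[of x j] by auto
    then show "i = j" using disjoint_pieces unfolding disjoint_family_on_def by blast
  qed
  show "(\<lambda>j. branch j x) ` {j. x \<in> T ` piece j} = T -` {x}"
  proof
    show "T -` {x} \<subseteq> (\<lambda>j. branch j x) ` {j. x \<in> T ` piece j}"
    proof
      fix y assume "y \<in> T -` {x}"
      then obtain j where j: "y \<in> piece j" "T y = x" using assms by auto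
      then show "y \<in> (\<lambda>j. branch j x) ` {j. x \<in> T ` piece j}"
        using branch_T[OF j(1)] by (intro image_eqI[of _ _ j]) auto
    qed
  qed (auto simp: T_branch)
qed

text \<open>
  Summing the change-of-variables formula over all inverse branches turns the integral of the fibre sum into
  the sum of the integrals of \<open>h\<close> over the pieces.
\<close>
lemma transfer_integrable:
  assumes h: "integrable (completion M) h" and nonneg: "\<And>x. 0 \<le> h x"
  shows "AE x in M. (\<lambda>y. \<rho> x y * h y) summable_on T -` {x}"
    and "integrable (completion M) (transfer T \<rho> h)"
    and "(LINT x|completion M. transfer T \<rho> h x) = (LINT x|completion M. h x)"
proof -
  obtain h' where h': "h' \<in> borel_measurable M" "AE x in M. h x = h' x"
    using completion_ex_borel_measurable_real[OF borel_measurable_integrable[OF h]] by blast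
  \<comment> \<open>A Borel version of \<open>h\<close>, truncated because \<open>h'\<close> may be negative on a null set.\<close>
  define h0 where "h0 x = max 0 (h' x)" for x
  have meas_h0 [measurable]: "h0 \<in> borel_measurable M" unfolding h0_def using h'(1) by measurable
  have h0_nonneg: "0 \<le> h0 x" for x by (simp add: h0_def)
  have h_h0: "AE x in M. h x = h0 x"
    using h'(2) by eventually_elim (metis h0_def max.absorb2 nonneg)
  have "integrable (completion M) h0"
    by (rule integrable_cong_AE_imp[OF h]) (auto intro: measurable_completion AE_completion h_h0)
  then have int_h0: "integrable M h0" by (simp add: integrable_completion)
  have "(LINT x|completion M. h x) = (LINT x|completion M. h0 x)"
    by (rule integral_cong_AE) (auto intro: measurable_completion AE_completion h_h0 borel_measurable_integrable[OF h])
  then have integral_h: "(LINT x|completion M. h x) = (LINT x|M. h0 x)" by (simp add: integral_completion)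
  define u where "u j x = indicator (T ` piece j) x * (h0 (branch j x) * \<rho> x (branch j x))" for j x
  have E: "(x, branch j x) \<in> orbit_eqrel T" if "x \<in> T ` piece j" for x j
    using partial_borel_injection_branch that unfolding partial_borel_injection_def by blast
  have u_nonneg: "0 \<le> u j x" for j x
    using \<rho>_pos[OF E, of x j] h0_nonneg[of "branch j x"] by (auto simp: u_def indicator_def less_imp_le)
  have int_u: "integrable M (u j)" for j
    using change_of_variables(1)[OF partial_borel_injection_branch int_h0, of j]
    by (simp add: set_integrable_def u_def[abs_def])
  have integral_u: "(LINT x|M. u j x) = (LINT x|M. h0 x * indicator (piece j) x)" for j
    using change_of_variables(2)[OF partial_borel_injection_branch int_h0, of j]
    by (simp add: set_lebesgue_integral_def u_def[abs_def] branch_image mult.commute)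
  define V where "V x = (\<Sum>j. ennreal (u j x))" for x
  have meas_u [measurable]: "u j \<in> borel_measurable M" for j using int_u by simp
  have meas_V [measurable]: "V \<in> borel_measurable M" unfolding V_def by measurable
  have "(\<integral>\<^sup>+x. V x \<partial>M) = (\<Sum>j. \<integral>\<^sup>+x. u j x \<partial>M)"
    unfolding V_def by (rule nn_integral_suminf) measurable
  also have "\<dots> = (\<Sum>j. \<integral>\<^sup>+x. ennreal (h0 x) * indicator (piece j) x \<partial>M)"
  proof (rule suminf_cong)
    fix j
    have "(\<integral>\<^sup>+x. u j x \<partial>M) = ennreal (LINT x|M. u j x)"
      using int_u u_nonneg by (intro nn_integral_eq_integral) auto
    also have "\<dots> = (\<integral>\<^sup>+x. ennreal (h0 x * indicator (piece j) x) \<partial>M)"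
      unfolding integral_u using int_h0 h0_nonneg
      by (intro nn_integral_eq_integral[symmetric] integrable_real_mult_indicator) auto
    also have "\<dots> = (\<integral>\<^sup>+x. ennreal (h0 x) * indicator (piece j) x \<partial>M)"
      by (intro nn_integral_cong) (auto simp: indicator_def)
    finally show "(\<integral>\<^sup>+x. u j x \<partial>M) = (\<integral>\<^sup>+x. ennreal (h0 x) * indicator (piece j) x \<partial>M)" .
  qed
  also have "\<dots> = (\<integral>\<^sup>+x. (\<Sum>j. ennreal (h0 x) * indicator (piece j) x) \<partial>M)"
    by (rule nn_integral_suminf[symmetric]) measurable
  also have "\<dots> = (\<integral>\<^sup>+x. h0 x \<partial>M)"
  proof (rule nn_integral_cong_AE)
    show "AE x in M. (\<Sum>j. ennreal (h0 x) * indicator (piece j) x) = ennreal (h0 x)"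
      using AE_not_in[OF off_pieces_null]
    proof eventually_elim
      case (elim x)
      then obtain i where "x \<in> piece i" by auto
      then show ?case using suminf_cmult_indicator[OF disjoint_pieces, of x i "\<lambda>_. ennreal (h0 x)"] by simp
    qed
  qed
  also have "\<dots> = ennreal (LINT x|M. h0 x)"
    using int_h0 h0_nonneg by (intro nn_integral_eq_integral) auto
  finally have integral_V: "(\<integral>\<^sup>+x. V x \<partial>M) = ennreal (LINT x|M. h0 x)" .
  then have fin: "AE x in M. V x \<noteq> \<infinity>" by (intro nn_integral_PInf_AE) auto
  \<comment> \<open>Almost everywhere agreement of \<open>h\<close> and \<open>h0\<close> says nothing about a single fibre; off \<open>R\<close> they agree on
    whole fibres.\<close>
  obtain R where R: "R \<in> null_sets M" "- (\<Union>n. piece n) \<subseteq> R" "\<And>x. x \<in> R \<Longrightarrow> T x \<in> R"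
      "\<And>x. x \<notin> R \<Longrightarrow> h x = h0 x"
    using AE_backward_closed[OF h_h0] by metis
  have has_sum: "AE x in M. ((\<lambda>y. \<rho> x y * h y) has_sum enn2real (V x)) (T -` {x})"
    using AE_not_in[OF R(1)] fin
  proof eventually_elim
    case (elim x)
    have pre: "y \<notin> R" if "T y = x" for y using elim(1) R(3) that by blast
    have V: "(\<Sum>j. ennreal (u j x)) \<noteq> top" using elim(2) by (simp add: V_def)
    then have "summable (\<lambda>j. u j x)" using u_nonneg by (intro summable_suminf_not_top)
    then have "(\<lambda>j. u j x) sums (\<Sum>j. u j x)" by (rule summable_sums)
    moreover have "(\<Sum>j. u j x) = enn2real (V x)"
      unfolding V_def suminf_ennreal[OF u_nonneg V] using u_nonneg \<open>summable (\<lambda>j. u j x)\<close>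
      by (simp add: suminf_nonneg)
    ultimately have "((\<lambda>j. u j x) has_sum enn2real (V x)) UNIV"
      using u_nonneg by (metis sums_nonneg_imp_has_sum)
    also have "?this \<longleftrightarrow> ((\<lambda>j. \<rho> x (branch j x) * h (branch j x)) has_sum enn2real (V x)) {j. x \<in> T ` piece j}"
    proof (rule has_sum_cong_neutral)
      fix j assume "j \<in> UNIV \<inter> {j. x \<in> T ` piece j}"
      then have j: "x \<in> T ` piece j" by simp
      then have "h (branch j x) = h0 (branch j x)" using R(4) pre T_branch(1) by blast
      with j show "u j x = \<rho> x (branch j x) * h (branch j x)" by (simp add: u_def)
    qed (auto simp: u_def)
    also have "\<dots> \<longleftrightarrow> ((\<lambda>y. \<rho> x y * h y) has_sum enn2real (V x)) (T -` {x})"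
      using pre R(2) by (intro has_sum_reindex_bij_betw[OF bij_betw_branches]) blast
    finally show ?case .
  qed
  then show "AE x in M. (\<lambda>y. \<rho> x y * h y) summable_on T -` {x}"
    by eventually_elim (rule has_sum_imp_summable)
  have tr: "AE x in M. transfer T \<rho> h x = enn2real (V x)"
    using has_sum by eventually_elim (simp add: transfer_def infsumI)
  have meas: "transfer T \<rho> h \<in> borel_measurable (completion M)"
    by (rule borel_measurable_completion_cong_AE[OF _ tr]) (rule measurable_completion, measurable)
  have "AE x in completion M. ennreal (transfer T \<rho> h x) = V x"
    using AE_completion[OF tr] AE_completion[OF fin] by eventually_elim (simp add: less_top)
  then have "(\<integral>\<^sup>+x. transfer T \<rho> h x \<partial>completion M) = (\<integral>\<^sup>+x. V x \<partial>completion M)"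
    by (rule nn_integral_cong_AE)
  also have "\<dots> = ennreal (LINT x|M. h0 x)"
    by (simp add: nn_integral_completion integral_V)
  finally have "(\<integral>\<^sup>+x. transfer T \<rho> h x \<partial>completion M) = ennreal (LINT x|M. h0 x)" .
  moreover have "AE x in completion M. 0 \<le> transfer T \<rho> h x"
    using AE_completion[OF tr] by eventually_elim simp
  moreover have "0 \<le> (LINT x|M. h0 x)" using h0_nonneg by (intro Bochner_Integration.integral_nonneg)
  ultimately have "integrable (completion M) (transfer T \<rho> h) \<and> (LINT x|completion M. transfer T \<rho> h x) = (LINT x|M. h0 x)"
    using nn_integral_eq_integrable[OF meas] by blast
  then show "integrable (completion M) (transfer T \<rho> h)"
    and "(LINT x|completion M. transfer T \<rho> h x) = (LINT x|completion M. h x)"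
    using integral_h by auto
qed

end

section \<open>Optimal trees\<close>

text \<open>
  The rooted trees of height at most \<open>n\<close>; the bound is what inductions run over.
\<close>
definition bounded_trees :: "('a \<Rightarrow> 'a) \<Rightarrow> nat \<Rightarrow> 'a \<Rightarrow> 'a set set" where
  "bounded_trees T n x = {\<tau>. \<tau> \<subseteq> (\<Union>i\<le>n. (T ^^ i) -` {x}) \<and> x \<in> \<tau> \<and> (\<forall>y\<in>\<tau>. y \<noteq> x \<longrightarrow> T y \<in> \<tau>)}"

lemma rooted_trees_eq: "rooted_trees T x = (\<Union>n. bounded_trees T n x)"
  by (auto simp: rooted_trees_def bounded_trees_def)

definition backward_orbit :: "('a \<Rightarrow> 'a) \<Rightarrow> 'a \<Rightarrow> 'a set" where
  "backward_orbit T y = {z. \<exists>k. (T ^^ k) z = y}"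

text \<open>
  The value of \<open>\<Sum>\<^sub>\<infinity>z\<in>\<tau>. g z * \<rho> x z\<close> at an optimal tree \<open>\<tau>\<close> of height at most \<open>n\<close> rooted at \<open>x\<close>.  Truncation at \<open>0\<close>
  corresponds to pruning all subtrees with a negative contribution.  For \<open>g \<ge> 0\<close> nothing is pruned, and
  the value is the sum over all points of height at most \<open>n\<close>; in this way the same recursion also controls
  absolute convergence.
\<close>
fun max_tree_sum :: "('a \<Rightarrow> 'a) \<Rightarrow> ('a \<Rightarrow> 'a \<Rightarrow> real) \<Rightarrow> ('a \<Rightarrow> real) \<Rightarrow> nat \<Rightarrow> 'a \<Rightarrow> real" where
  "max_tree_sum T \<rho> g 0 x = g x"
| "max_tree_sum T \<rho> g (Suc n) x = g x + transfer T \<rho> (\<lambda>y. max 0 (max_tree_sum T \<rho> g n y)) x"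

locale aperiodic_cocycle =
  fixes T :: "'a \<Rightarrow> 'a" and \<rho> :: "'a \<Rightarrow> 'a \<Rightarrow> real"
  assumes aperiodic_T: "aperiodic T"
    and \<rho>_pos: "(x, y) \<in> orbit_eqrel T \<Longrightarrow> 0 < \<rho> x y"
    and \<rho>_mult: "(x, y) \<in> orbit_eqrel T \<Longrightarrow> (y, z) \<in> orbit_eqrel T \<Longrightarrow> \<rho> x y * \<rho> y z = \<rho> x z"
begin

lemma backward_orbit_related: "z \<in> backward_orbit T y \<Longrightarrow> (y, z) \<in> orbit_eqrel T"
proof -
  assume "z \<in> backward_orbit T y"
  then obtain k where "(T ^^ 0) y = (T ^^ k) z" by (auto simp: backward_orbit_def)
  then show ?thesis unfolding orbit_eqrel_def by blast
qed

lemma preimage_related: "T y = x \<Longrightarrow> (x, y) \<in> orbit_eqrel T"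
  by (rule backward_orbit_related) (auto simp: backward_orbit_def intro: exI[of _ 1])

lemma \<rho>_self [simp]: "\<rho> x x = 1"
proof -
  have E: "(x, x) \<in> orbit_eqrel T" by (auto simp: orbit_eqrel_def)
  show ?thesis using \<rho>_pos[OF E] \<rho>_mult[OF E E] by simp
qed

text \<open>
  Aperiodicity enters the combinatorics here: every point of a backward orbit has a definite height.
\<close>
lemma exponent_unique:
  assumes "(T ^^ i) z = x" "(T ^^ j) z = x" shows "i = j"
proof -
  have "i = j" if "i \<le> j" "(T ^^ i) z = x" "(T ^^ j) z = x" for i j
  proof (rule ccontr)
    assume "i \<noteq> j"
    then have "1 \<le> j - i" using that(1) by simp
    moreover have "(T ^^ (j - i)) x = x"
      using that funpow_add[of "j - i" i T] by auto
    ultimately show False using aperiodic_T unfolding aperiodic_def by blast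
  qed
  from this[of i j] this[of j i] assms show ?thesis by (cases "i \<le> j") auto
qed

lemma backward_orbit_disjoint:
  assumes "T y = x" "T y' = x" "z \<in> backward_orbit T y" "z \<in> backward_orbit T y'"
  shows "y = y'"
proof -
  obtain k k' where k: "(T ^^ k) z = y" "(T ^^ k') z = y'" using assms(3,4) by (auto simp: backward_orbit_def)
  then have "(T ^^ Suc k) z = x" "(T ^^ Suc k') z = x" using assms(1,2) by auto
  then have "k = k'" using exponent_unique by blast
  with k show ?thesis by simp
qed

lemma root_not_in_backward_orbit: assumes "T y = x" shows "x \<notin> backward_orbit T y"
proof
  assume "x \<in> backward_orbit T y"
  then obtain k where "(T ^^ k) x = y" by (auto simp: backward_orbit_def)
  then have "(T ^^ Suc k) x = (T ^^ 0) x" using assms by simp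
  then show False using exponent_unique[of "Suc k" x "x" 0] by simp
qed

lemma bounded_trees_subset_backward_orbit: "\<tau> \<in> bounded_trees T n y \<Longrightarrow> \<tau> \<subseteq> backward_orbit T y"
  by (auto simp: bounded_trees_def backward_orbit_def)

lemma bounded_trees_0 [simp]: "bounded_trees T 0 x = {{x}}"
  by (auto simp: bounded_trees_def)

text \<open>
  The path from a point of \<open>\<tau>\<close> to the root stays in \<open>\<tau>\<close> and passes through exactly one preimage of the root.
\<close>
lemma bounded_trees_Suc_decompose:
  assumes \<tau>: "\<tau> \<in> bounded_trees T (Suc n) x"
  defines "S \<equiv> \<tau> \<inter> T -` {x}"
  shows "\<tau> = insert x (\<Union>y\<in>S. \<tau> \<inter> backward_orbit T y)"
    and "y \<in> S \<Longrightarrow> \<tau> \<inter> backward_orbit T y \<in> bounded_trees T n y"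
proof -
  have x: "x \<in> \<tau>" and closed: "\<And>z. z \<in> \<tau> \<Longrightarrow> z \<noteq> x \<Longrightarrow> T z \<in> \<tau>"
    and height: "\<And>z. z \<in> \<tau> \<Longrightarrow> \<exists>i\<le>Suc n. (T ^^ i) z = x"
    using \<tau> by (auto simp: bounded_trees_def)
  have path: "(T ^^ j) z \<in> \<tau>" if "z \<in> \<tau>" "(T ^^ i) z = x" "j \<le> i" for z i j
    using that(3)
  proof (induction j)
    case 0 then show ?case using that by simp
  next
    case (Suc j)
    have "(T ^^ j) z \<noteq> x" using exponent_unique[of j z x i] that(2) Suc.prems by auto
    then show ?case using Suc closed by auto
  qed
  show "\<tau> = insert x (\<Union>y\<in>S. \<tau> \<inter> backward_orbit T y)"
  proof
    show "\<tau> \<subseteq> insert x (\<Union>y\<in>S. \<tau> \<inter> backward_orbit T y)"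
    proof
      fix z assume z: "z \<in> \<tau>"
      then obtain i where i: "(T ^^ i) z = x" using height by blast
      show "z \<in> insert x (\<Union>y\<in>S. \<tau> \<inter> backward_orbit T y)"
      proof (cases i)
        case 0 then show ?thesis using i by simp
      next
        case (Suc k)
        then have "(T ^^ k) z \<in> S" using path[OF z i, of k] i by (auto simp: S_def)
        then show ?thesis using z by (auto simp: backward_orbit_def)
      qed
    qed
  qed (auto simp: x)
  show "\<tau> \<inter> backward_orbit T y \<in> bounded_trees T n y" if y: "y \<in> S"
  proof -
    have Ty: "T y = x" and y\<tau>: "y \<in> \<tau>" using y by (auto simp: S_def)
    have "\<exists>i\<le>n. (T ^^ i) z = y" if z: "z \<in> \<tau>" "z \<in> backward_orbit T y" for z
    proof -
      obtain k where k: "(T ^^ k) z = y" using z by (auto simp: backward_orbit_def)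
      obtain i where i: "i \<le> Suc n" "(T ^^ i) z = x" using height z by blast
      have "(T ^^ Suc k) z = x" using k Ty by simp
      then have "Suc k = i" using exponent_unique i by blast
      then show ?thesis using i k by auto
    qed
    moreover have "y \<in> backward_orbit T y" by (auto simp: backward_orbit_def intro: exI[of _ 0])
    moreover have "T z \<in> \<tau> \<inter> backward_orbit T y" if z: "z \<in> \<tau>" "z \<in> backward_orbit T y" "z \<noteq> y" for z
    proof -
      obtain k where k: "(T ^^ k) z = y" using z by (auto simp: backward_orbit_def)
      then obtain k' where "k = Suc k'" using z(3) by (cases k) auto
      then have "(T ^^ k') (T z) = y" using k by (simp add: funpow_swap1)
      then have "T z \<in> backward_orbit T y" by (auto simp: backward_orbit_def)
      moreover have "z \<noteq> x" using root_not_in_backward_orbit[OF Ty] z(2) by blast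
      ultimately show ?thesis using closed z(1) by blast
    qed
    ultimately show ?thesis using y\<tau> unfolding bounded_trees_def by blast
  qed
qed

lemma bounded_trees_Suc_graft:
  assumes S: "S \<subseteq> T -` {x}" and t: "\<And>y. y \<in> S \<Longrightarrow> t y \<in> bounded_trees T n y"
  shows "insert x (\<Union>y\<in>S. t y) \<in> bounded_trees T (Suc n) x"
proof -
  have "\<exists>i\<le>Suc n. (T ^^ i) z = x" if yz: "y \<in> S" "z \<in> t y" for y z
  proof -
    obtain i where "i \<le> n" "(T ^^ i) z = y" using t[OF yz(1)] yz(2) by (auto simp: bounded_trees_def)
    then have "Suc i \<le> Suc n \<and> (T ^^ Suc i) z = x" using S yz(1) by auto
    then show ?thesis by blast
  qed
  moreover have "\<exists>i\<le>Suc n. (T ^^ i) x = x" by (auto intro: exI[of _ 0])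
  moreover have closed: "T z \<in> insert x (\<Union>y\<in>S. t y)" if "y \<in> S" "z \<in> t y" for y z
    using t[OF that(1)] that S by (cases "z = y") (auto simp: bounded_trees_def)
  ultimately have "\<exists>i\<le>Suc n. (T ^^ i) z = x" if "z \<in> insert x (\<Union>y\<in>S. t y)" for z
    using that by blast
  then have "insert x (\<Union>y\<in>S. t y) \<subseteq> (\<Union>i\<le>Suc n. (T ^^ i) -` {x})" by fastforce
  then show ?thesis unfolding bounded_trees_def using closed by blast
qed

lemma full_tree: "(\<Union>i\<le>n. (T ^^ i) -` {x}) \<in> bounded_trees T n x"
proof -
  have "x \<in> (\<Union>i\<le>n. (T ^^ i) -` {x})" by (auto intro!: bexI[of _ 0])
  moreover have "T z \<in> (\<Union>i\<le>n. (T ^^ i) -` {x})" if z: "z \<in> (\<Union>i\<le>n. (T ^^ i) -` {x})" "z \<noteq> x" for z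
  proof -
    obtain i where i: "i \<le> n" "(T ^^ i) z = x" using z(1) by auto
    then obtain k where "i = Suc k" using z(2) by (cases i) auto
    then have "k \<le> n" "(T ^^ k) (T z) = x" using i by (auto simp: funpow_swap1)
    then show ?thesis by auto
  qed
  ultimately show ?thesis unfolding bounded_trees_def by blast
qed

lemma full_tree_Suc:
  "(\<Union>i\<le>Suc n. (T ^^ i) -` {x}) = insert x (\<Union>y\<in>T -` {x}. \<Union>i\<le>n. (T ^^ i) -` {y})"
proof
  show "(\<Union>i\<le>Suc n. (T ^^ i) -` {x}) \<subseteq> insert x (\<Union>y\<in>T -` {x}. \<Union>i\<le>n. (T ^^ i) -` {y})"
  proof
    fix z assume "z \<in> (\<Union>i\<le>Suc n. (T ^^ i) -` {x})"
    then obtain i where i: "i \<le> Suc n" "(T ^^ i) z = x" by auto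
    then show "z \<in> insert x (\<Union>y\<in>T -` {x}. \<Union>i\<le>n. (T ^^ i) -` {y})"
      by (cases i) auto
  qed
  have "insert x (\<Union>y\<in>T -` {x}. \<Union>i\<le>n. (T ^^ i) -` {y}) \<in> bounded_trees T (Suc n) x"
    by (intro bounded_trees_Suc_graft full_tree) auto
  then show "insert x (\<Union>y\<in>T -` {x}. \<Union>i\<le>n. (T ^^ i) -` {y}) \<subseteq> (\<Union>i\<le>Suc n. (T ^^ i) -` {x})"
    by (auto simp: bounded_trees_def)
qed

context
  fixes S x and t :: "'a \<Rightarrow> 'a set" and g s :: "'a \<Rightarrow> real"
  assumes S: "S \<subseteq> T -` {x}" and t: "\<And>y. y \<in> S \<Longrightarrow> t y \<subseteq> backward_orbit T y"
    and s: "\<And>y. y \<in> S \<Longrightarrow> ((\<lambda>z. g z * \<rho> y z) has_sum s y) (t y)"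
begin

text \<open>
  Distinct preimages of \<open>x\<close> have disjoint backward orbits, so sums over a union of subtrees are iterated sums.
\<close>
lemma graft_bij: "bij_betw snd (Sigma S t) (\<Union>y\<in>S. t y)"
  unfolding bij_betw_def
proof
  show "inj_on snd (Sigma S t)"
  proof (rule inj_onI)
    fix v w assume vw: "v \<in> Sigma S t" "w \<in> Sigma S t" "snd v = snd w"
    then have "fst v \<in> S" "fst w \<in> S" "snd v \<in> t (fst v)" "snd v \<in> t (fst w)" by auto
    then have "fst v = fst w" using S t by (intro backward_orbit_disjoint[of "fst v" x "fst w" "snd v"]) auto
    with vw(3) show "v = w" by (simp add: prod_eq_iff)
  qed
qed force

text \<open>
  The cocycle identity moves the base point of the weights from \<open>x\<close> to its preimage \<open>y\<close>.
\<close>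
lemma graft_branch: "y \<in> S \<Longrightarrow> ((\<lambda>z. g z * \<rho> x z) has_sum (\<rho> x y * s y)) (t y)"
proof -
  assume y: "y \<in> S"
  then have Ty: "T y = x" using S by auto
  have "((\<lambda>z. \<rho> x y * (g z * \<rho> y z)) has_sum (\<rho> x y * s y)) (t y)"
    using s[OF y] by (rule has_sum_cmult_right)
  also have "?this \<longleftrightarrow> ?thesis"
  proof (rule has_sum_cong)
    fix z assume "z \<in> t y"
    then have "(y, z) \<in> orbit_eqrel T" using t[OF y] backward_orbit_related by blast
    then show "\<rho> x y * (g z * \<rho> y z) = g z * \<rho> x z"
      using \<rho>_mult[OF preimage_related[OF Ty], of z] by (simp add: algebra_simps)
  qed
  finally show ?thesis .
qed

text \<open>
  For nonnegative \<open>g\<close> convergence of the iterated sum implies convergence of the sum over the tree.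
\<close>
lemma graft_has_sum_nonneg:
  assumes g: "\<And>z. 0 \<le> g z" and \<sigma>: "((\<lambda>y. \<rho> x y * s y) has_sum \<sigma>) S"
  shows "((\<lambda>z. g z * \<rho> x z) has_sum (g x + \<sigma>)) (insert x (\<Union>y\<in>S. t y))"
proof -
  have pos: "0 \<le> g z * \<rho> x z" if "y \<in> S" "z \<in> t y" for y z
  proof -
    have "(x, y) \<in> orbit_eqrel T" "(y, z) \<in> orbit_eqrel T"
      using that S t backward_orbit_related preimage_related by blast+
    then have "0 < \<rho> x z" using \<rho>_pos \<rho>_mult by (metis mult_pos_pos)
    then show ?thesis using g by simp
  qed
  have "(\<lambda>(y, z). g z * \<rho> x z) summable_on Sigma S t"
    by (rule summable_on_SigmaI[where g = "\<lambda>y. \<rho> x y * s y"])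
      (use graft_branch \<sigma> pos in \<open>auto intro: has_sum_imp_summable\<close>)
  then have "((\<lambda>(y, z). g z * \<rho> x z) has_sum \<sigma>) (Sigma S t)"
    by (intro has_sum_SigmaI[OF _ \<sigma>]) (auto intro: graft_branch)
  then have "((\<lambda>w. g (snd w) * \<rho> x (snd w)) has_sum \<sigma>) (Sigma S t)"
    by (simp add: case_prod_unfold)
  then have "((\<lambda>z. g z * \<rho> x z) has_sum \<sigma>) (\<Union>y\<in>S. t y)"
    using has_sum_reindex_bij_betw[OF graft_bij, of "\<lambda>z. g z * \<rho> x z"] by simp
  moreover have "x \<notin> (\<Union>y\<in>S. t y)" using S t root_not_in_backward_orbit by blast
  ultimately show ?thesis using has_sum_insert[of x _ "\<lambda>z. g z * \<rho> x z"] by fastforce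
qed

text \<open>
  For signed \<open>g\<close> convergence of the sum over the tree has to be known in advance.
\<close>
lemma graft_infsum:
  assumes "(\<lambda>z. g z * \<rho> x z) summable_on (\<Union>y\<in>S. t y)"
  shows "(\<lambda>y. \<rho> x y * s y) summable_on S"
    and "(\<Sum>\<^sub>\<infinity>z\<in>insert x (\<Union>y\<in>S. t y). g z * \<rho> x z) = g x + (\<Sum>\<^sub>\<infinity>y\<in>S. \<rho> x y * s y)"
proof -
  obtain \<sigma> where \<sigma>: "((\<lambda>z. g z * \<rho> x z) has_sum \<sigma>) (\<Union>y\<in>S. t y)"
    using assms by (auto simp: summable_on_def)
  then have "((\<lambda>w. g (snd w) * \<rho> x (snd w)) has_sum \<sigma>) (Sigma S t)"
    using has_sum_reindex_bij_betw[OF graft_bij, of "\<lambda>z. g z * \<rho> x z"] by simp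
  then have *: "((\<lambda>y. \<rho> x y * s y) has_sum \<sigma>) S"
    by (rule has_sum_SigmaD) (simp add: graft_branch)
  then show "(\<lambda>y. \<rho> x y * s y) summable_on S" by (rule has_sum_imp_summable)
  have "x \<notin> (\<Union>y\<in>S. t y)" using S t root_not_in_backward_orbit by blast
  then have "((\<lambda>z. g z * \<rho> x z) has_sum (g x * \<rho> x x + \<sigma>)) (insert x (\<Union>y\<in>S. t y))"
    using \<sigma> by (rule has_sum_insert)
  then show "(\<Sum>\<^sub>\<infinity>z\<in>insert x (\<Union>y\<in>S. t y). g z * \<rho> x z) = g x + (\<Sum>\<^sub>\<infinity>y\<in>S. \<rho> x y * s y)"
    using infsumI[OF *] infsumI by fastforce
qed

end

lemma transfer_nonneg: "(\<And>y. 0 \<le> h y) \<Longrightarrow> 0 \<le> transfer T \<rho> h x"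
  unfolding transfer_def using \<rho>_pos[OF preimage_related]
  by (intro infsum_nonneg mult_nonneg_nonneg) (auto simp: less_imp_le)

lemma max_tree_sum_nonneg: "(\<And>z. 0 \<le> \<phi> z) \<Longrightarrow> 0 \<le> max_tree_sum T \<rho> \<phi> n x"
  by (cases n) (simp_all add: add_nonneg_nonneg transfer_nonneg)

text \<open>
  The convergence needed for the recursion to have its intended meaning at every point of \<open>H\<close>; elsewhere an infinite
  sum could take the default value \<open>0\<close>.
\<close>
definition regular_on :: "'a set \<Rightarrow> ('a \<Rightarrow> real) \<Rightarrow> bool" where
  "regular_on H g \<longleftrightarrow> (\<forall>x\<in>H. \<forall>n. (\<lambda>y. \<rho> x y * max 0 (max_tree_sum T \<rho> g n y)) summable_on T -` {x})"

lemma full_tree_has_sum: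
  assumes H: "\<And>y. T y \<in> H \<Longrightarrow> y \<in> H" and nonneg: "\<And>z. 0 \<le> \<phi> z" and reg: "regular_on H \<phi>"
  shows "x \<in> H \<Longrightarrow> ((\<lambda>z. \<phi> z * \<rho> x z) has_sum max_tree_sum T \<rho> \<phi> n x) (\<Union>i\<le>n. (T ^^ i) -` {x})"
proof (induction n arbitrary: x)
  case 0
  have "((\<lambda>z. \<phi> z * \<rho> x z) has_sum (\<Sum>z\<in>{x}. \<phi> z * \<rho> x z)) {x}" by (rule has_sum_finite) simp
  moreover have "(\<Union>i\<le>0. (T ^^ i) -` {x}) = {x}" by auto
  ultimately show ?case by simp
next
  case (Suc n)
  define \<sigma> where "\<sigma> = transfer T \<rho> (\<lambda>y. max 0 (max_tree_sum T \<rho> \<phi> n y)) x"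
  have "((\<lambda>y. \<rho> x y * max 0 (max_tree_sum T \<rho> \<phi> n y)) has_sum \<sigma>) (T -` {x})"
    unfolding \<sigma>_def transfer_def by (rule has_sum_infsum) (use reg Suc.prems in \<open>simp add: regular_on_def\<close>)
  moreover have "max 0 (max_tree_sum T \<rho> \<phi> n y) = max_tree_sum T \<rho> \<phi> n y" for y
    using max_tree_sum_nonneg[of \<phi> n, OF nonneg] by (simp add: max_absorb2)
  ultimately have "((\<lambda>y. \<rho> x y * max_tree_sum T \<rho> \<phi> n y) has_sum \<sigma>) (T -` {x})" by simp
  moreover have "((\<lambda>z. \<phi> z * \<rho> y z) has_sum max_tree_sum T \<rho> \<phi> n y) (\<Union>i\<le>n. (T ^^ i) -` {y})" if "y \<in> T -` {x}" for y
    using that Suc H by auto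
  moreover have "(\<Union>i\<le>n. (T ^^ i) -` {y}) \<subseteq> backward_orbit T y" for y by (auto simp: backward_orbit_def)
  ultimately show ?case unfolding full_tree_Suc max_tree_sum.simps \<sigma>_def[symmetric]
    by (intro graft_has_sum_nonneg[OF order_refl, where s = "max_tree_sum T \<rho> \<phi> n"] nonneg)
qed

lemma tree_sum_summable:
  assumes H: "\<And>y. T y \<in> H \<Longrightarrow> y \<in> H" and dom: "\<And>z. \<bar>g z\<bar> \<le> \<phi> z" and reg: "regular_on H \<phi>"
    and x: "x \<in> H" and \<tau>: "\<tau> \<in> bounded_trees T n x"
  shows "(\<lambda>z. g z * \<rho> x z) summable_on \<tau>"
proof -
  have "0 \<le> \<phi> z" for z using dom[of z] by linarith
  then have "(\<lambda>z. \<phi> z * \<rho> x z) summable_on (\<Union>i\<le>n. (T ^^ i) -` {x})"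
    using full_tree_has_sum[OF H _ reg x] has_sum_imp_summable by blast
  then have "(\<lambda>z. \<phi> z * \<rho> x z) summable_on \<tau>"
    using \<tau> by (auto simp: bounded_trees_def intro: summable_on_subset_banach)
  then have "(\<lambda>z. norm (g z * \<rho> x z)) summable_on \<tau>"
  proof (rule Infinite_Sum.abs_summable_on_comparison_test')
    fix z assume "z \<in> \<tau>"
    then have "0 < \<rho> x z" using bounded_trees_subset_backward_orbit[OF \<tau>] backward_orbit_related \<rho>_pos by blast
    then show "norm (g z * \<rho> x z) \<le> \<phi> z * \<rho> x z" using dom[of z] by (simp add: abs_mult)
  qed
  then show ?thesis by (rule abs_summable_summable)
qed

text \<open>
  Induction on the height: replacing each subtree at a preimage by an optimal one, and dropping those with a
  negative sum, does not decrease the sum.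
\<close>
lemma tree_sum_le_max:
  assumes H: "\<And>y. T y \<in> H \<Longrightarrow> y \<in> H" and dom: "\<And>z. \<bar>g z\<bar> \<le> \<phi> z"
    and reg: "regular_on H \<phi>" "regular_on H g"
  shows "x \<in> H \<Longrightarrow> \<tau> \<in> bounded_trees T n x \<Longrightarrow> (\<Sum>\<^sub>\<infinity>z\<in>\<tau>. g z * \<rho> x z) \<le> max_tree_sum T \<rho> g n x"
proof (induction n arbitrary: x \<tau>)
  case (Suc n)
  define S where "S = \<tau> \<inter> T -` {x}"
  define t where "t y = \<tau> \<inter> backward_orbit T y" for y
  define s where "s y = (\<Sum>\<^sub>\<infinity>z\<in>t y. g z * \<rho> y z)" for y
  have \<tau>: "\<tau> = insert x (\<Union>y\<in>S. t y)" and t: "\<And>y. y \<in> S \<Longrightarrow> t y \<in> bounded_trees T n y"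
    using bounded_trees_Suc_decompose[OF Suc.prems(2)] unfolding S_def t_def by auto
  have SH: "y \<in> H" if "y \<in> S" for y using that Suc.prems H by (auto simp: S_def)
  have S: "S \<subseteq> T -` {x}" by (auto simp: S_def)
  have tA: "t y \<subseteq> backward_orbit T y" for y by (simp add: t_def)
  have s: "((\<lambda>z. g z * \<rho> y z) has_sum s y) (t y)" if "y \<in> S" for y
    unfolding s_def using tree_sum_summable[OF H dom reg(1) SH[OF that] t[OF that]] by simp
  have summ: "(\<lambda>z. g z * \<rho> x z) summable_on (\<Union>y\<in>S. t y)"
    using tree_sum_summable[OF H dom reg(1) Suc.prems] by (rule summable_on_subset_banach) (use \<tau> in blast)+
  note graft = graft_infsum[OF S tA s summ]
  have "(\<Sum>\<^sub>\<infinity>y\<in>S. \<rho> x y * s y) \<le> (\<Sum>\<^sub>\<infinity>y\<in>T -` {x}. \<rho> x y * max 0 (max_tree_sum T \<rho> g n y))"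
  proof (rule infsum_mono_neutral)
    show "(\<lambda>y. \<rho> x y * s y) summable_on S" using graft(1) by blast
    show "(\<lambda>y. \<rho> x y * max 0 (max_tree_sum T \<rho> g n y)) summable_on T -` {x}"
      using reg(2) Suc.prems(1) by (simp add: regular_on_def)
    have pos: "0 < \<rho> x y" if "y \<in> T -` {x}" for y using that \<rho>_pos preimage_related by auto
    show "\<rho> x y * s y \<le> \<rho> x y * max 0 (max_tree_sum T \<rho> g n y)" if "y \<in> S \<inter> T -` {x}" for y
      using that Suc.IH[OF SH t, of y] pos[of y] by (auto simp: s_def intro!: mult_left_mono)
    show "0 \<le> \<rho> x y * max 0 (max_tree_sum T \<rho> g n y)" if "y \<in> T -` {x} - S" for y
      using that pos[of y] by auto
  qed (use S in auto)
  then show ?case using graft(2) \<tau> by (simp add: transfer_def)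
qed simp

text \<open>
  Grafting optimal trees at exactly the preimages with a positive optimal sum realizes the recursion.
\<close>
lemma max_tree_sum_attained:
  assumes H: "\<And>y. T y \<in> H \<Longrightarrow> y \<in> H" and dom: "\<And>z. \<bar>g z\<bar> \<le> \<phi> z"
    and reg: "regular_on H \<phi>"
  shows "x \<in> H \<Longrightarrow> \<exists>\<tau>\<in>bounded_trees T n x. (\<Sum>\<^sub>\<infinity>z\<in>\<tau>. g z * \<rho> x z) = max_tree_sum T \<rho> g n x"
proof (induction n arbitrary: x)
  case (Suc n)
  define S where "S = {y \<in> T -` {x}. 0 < max_tree_sum T \<rho> g n y}"
  have SH: "y \<in> H" if "y \<in> S" for y using that Suc.prems H by (auto simp: S_def)
  have "\<forall>y\<in>S. \<exists>\<tau>. \<tau> \<in> bounded_trees T n y \<and> (\<Sum>\<^sub>\<infinity>z\<in>\<tau>. g z * \<rho> y z) = max_tree_sum T \<rho> g n y"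
    using Suc.IH SH by blast
  then obtain t where t: "\<And>y. y \<in> S \<Longrightarrow> t y \<in> bounded_trees T n y"
      "\<And>y. y \<in> S \<Longrightarrow> (\<Sum>\<^sub>\<infinity>z\<in>t y. g z * \<rho> y z) = max_tree_sum T \<rho> g n y" by metis
  have S: "S \<subseteq> T -` {x}" by (auto simp: S_def)
  have \<tau>: "insert x (\<Union>y\<in>S. t y) \<in> bounded_trees T (Suc n) x" using S t(1) by (rule bounded_trees_Suc_graft)
  have tA: "t y \<subseteq> backward_orbit T y" if "y \<in> S" for y using bounded_trees_subset_backward_orbit[OF t(1)[OF that]] .
  have s: "((\<lambda>z. g z * \<rho> y z) has_sum max_tree_sum T \<rho> g n y) (t y)" if "y \<in> S" for y
    using tree_sum_summable[OF H dom reg SH[OF that] t(1)[OF that]] t(2)[OF that] by (metis has_sum_infsum)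
  have "(\<lambda>z. g z * \<rho> x z) summable_on (\<Union>y\<in>S. t y)"
    using tree_sum_summable[OF H dom reg Suc.prems \<tau>] by (rule summable_on_subset_banach) blast+
  then have "(\<Sum>\<^sub>\<infinity>z\<in>insert x (\<Union>y\<in>S. t y). g z * \<rho> x z) = g x + (\<Sum>\<^sub>\<infinity>y\<in>S. \<rho> x y * max_tree_sum T \<rho> g n y)"
    by (intro graft_infsum(2)[OF S tA s])
  also have "(\<Sum>\<^sub>\<infinity>y\<in>S. \<rho> x y * max_tree_sum T \<rho> g n y) = (\<Sum>\<^sub>\<infinity>y\<in>T -` {x}. \<rho> x y * max 0 (max_tree_sum T \<rho> g n y))"
    by (rule infsum_cong_neutral) (auto simp: S_def)
  finally show ?case using \<tau> by (auto simp: transfer_def)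
qed simp

lemma max_tree_sum_mono:
  assumes H: "\<And>y. T y \<in> H \<Longrightarrow> y \<in> H" and reg: "regular_on H g"
  shows "x \<in> H \<Longrightarrow> max_tree_sum T \<rho> g n x \<le> max_tree_sum T \<rho> g (Suc n) x"
proof (induction n arbitrary: x)
  case 0
  show ?case by (simp add: transfer_nonneg)
next
  case (Suc n)
  have "transfer T \<rho> (\<lambda>y. max 0 (max_tree_sum T \<rho> g n y)) x \<le> transfer T \<rho> (\<lambda>y. max 0 (max_tree_sum T \<rho> g (Suc n) y)) x"
    unfolding transfer_def
  proof (rule infsum_mono)
    fix y assume y: "y \<in> T -` {x}"
    then have "max_tree_sum T \<rho> g n y \<le> max_tree_sum T \<rho> g (Suc n) y" using Suc H by auto
    moreover have "0 < \<rho> x y" using y \<rho>_pos preimage_related by auto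
    ultimately show "\<rho> x y * max 0 (max_tree_sum T \<rho> g n y) \<le> \<rho> x y * max 0 (max_tree_sum T \<rho> g (Suc n) y)"
      by (intro mult_left_mono) auto
  qed (use reg Suc.prems in \<open>auto simp: regular_on_def simp del: max_tree_sum.simps\<close>)
  then show ?case by simp
qed

end

section \<open>The maximal inequality\<close>

locale aperiodic_cocycle_system = nonsingular_cocycle_system +
  assumes aperiodic: "aperiodic T"

sublocale aperiodic_cocycle_system \<subseteq> tree: aperiodic_cocycle T \<rho>
proof
  show "\<rho> x y * \<rho> y z = \<rho> x z" if "(x, y) \<in> orbit_eqrel T" "(y, z) \<in> orbit_eqrel T" for x y z
    using cocycle that unfolding RN_cocycle_def by blast
qed (use aperiodic \<rho>_pos in auto)

context aperiodic_cocycle_system begin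

lemma finite_measure_completion: "finite_measure (completion M)"
proof (rule finite_measureI)
  have "UNIV \<in> sets M" using sets.top[of M] by simp
  then show "emeasure (completion M) (space (completion M)) \<noteq> \<infinity>"
    using emeasure_finite[of UNIV] by simp
qed

lemma max_tree_sum_integrable:
  assumes g: "integrable (completion M) g"
  shows "integrable (completion M) (max_tree_sum T \<rho> g n)"
proof (induction n)
  case 0
  then show ?case using g by simp
next
  case (Suc n)
  have "integrable (completion M) (transfer T \<rho> (\<lambda>y. max 0 (max_tree_sum T \<rho> g n y)))"
    by (rule transfer_integrable(2)) (use Suc in auto)
  then show ?case using g by simp
qed

lemma AE_summable_max_tree_sum:
  assumes g: "integrable (completion M) g"
  shows "AE x in M. \<forall>n. (\<lambda>y. \<rho> x y * max 0 (max_tree_sum T \<rho> g n y)) summable_on T -` {x}"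
  unfolding AE_all_countable by (intro allI transfer_integrable(1)) (use max_tree_sum_integrable[OF g] in auto)

text \<open>
  All convergence requirements hold simultaneously on one conull set that contains every backward tree of
  each of its points.
\<close>
lemma exists_regular_conull:
  assumes "integrable (completion M) g" "integrable (completion M) \<phi>"
  obtains H where "- H \<in> null_sets M" "\<And>y. T y \<in> H \<Longrightarrow> y \<in> H" "tree.regular_on H g" "tree.regular_on H \<phi>"
proof -
  define P where "P h x \<longleftrightarrow> (\<forall>n. (\<lambda>y. \<rho> x y * max 0 (max_tree_sum T \<rho> h n y)) summable_on T -` {x})" for h x
  have "AE x in M. P g x \<and> P \<phi> x" unfolding P_def using assms AE_summable_max_tree_sum by (auto intro: AE_conjI)
  then obtain R where R: "R \<in> null_sets M" "\<And>x. x \<in> R \<Longrightarrow> T x \<in> R" "\<And>x. x \<notin> R \<Longrightarrow> P g x \<and> P \<phi> x"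
    by (rule AE_backward_closed) (rule that)
  show thesis by (rule that[of "- R"]) (use R in \<open>auto simp: tree.regular_on_def P_def\<close>)
qed

lemma level_set_in_sets:
  assumes g: "integrable (completion M) g" and H: "- H \<in> null_sets M"
  shows "{x \<in> H. 0 < max_tree_sum T \<rho> g n x} \<in> sets (completion M)"
proof -
  have [measurable]: "max_tree_sum T \<rho> g n \<in> borel_measurable (completion M)" using max_tree_sum_integrable[OF g, of n] by simp
  have [measurable]: "H \<in> sets (completion M)"
    using sets.compl_sets[OF null_setsD2[OF H]] by (simp add: Compl_eq_Diff_UNIV[symmetric])
  have "{x \<in> space (completion M). 0 < max_tree_sum T \<rho> g n x} \<inter> H \<in> sets (completion M)" by measurable
  also have "{x \<in> space (completion M). 0 < max_tree_sum T \<rho> g n x} \<inter> H = {x \<in> H. 0 < max_tree_sum T \<rho> g n x}" by auto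
  finally show ?thesis .
qed

text \<open>
  Hopf's argument.  With \<open>F n\<close> the optimal sum and \<open>L\<close> the transfer of \<open>(F k)\<^sup>+\<close>, where \<open>n = k + 1\<close>, the recursion reads
  \<open>F n = g + L\<close>.  Therefore \<open>(F n)\<^sup>+ - L\<close> equals \<open>g\<close> where \<open>F n > 0\<close> and is at most \<open>0\<close> elsewhere, while its
  integral is \<open>\<integral> (F n)\<^sup>+ - \<integral> (F k)\<^sup>+ \<ge> 0\<close>.
\<close>
lemma level_maximal_inequality:
  assumes g: "integrable (completion M) g" and H: "- H \<in> null_sets M" "\<And>y. T y \<in> H \<Longrightarrow> y \<in> H"
    and reg: "tree.regular_on H g"
  shows "0 \<le> (LINT x:{x \<in> H. 0 < max_tree_sum T \<rho> g n x}|completion M. g x)"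
proof -
  have AE_H: "AE x in completion M. x \<in> H" using AE_completion[OF AE_not_in[OF H(1)]] by simp
  define F where "F = max_tree_sum T \<rho> g"
  have F_int: "integrable (completion M) (\<lambda>x. max 0 (F n x))" for n
    using max_tree_sum_integrable[OF g, of n] by (simp add: F_def)
  have sets: "{x \<in> H. 0 < F n x} \<in> sets (completion M)"
    unfolding F_def by (rule level_set_in_sets[OF g H(1)])
  show ?thesis
  proof (cases n)
    case 0
    show ?thesis unfolding set_lebesgue_integral_def 0
      by (intro Bochner_Integration.integral_nonneg) (auto simp: indicator_def)
  next
    case (Suc k)
    define L where "L = transfer T \<rho> (\<lambda>y. max 0 (F k y))"
    have L: "integrable (completion M) L" "(LINT x|completion M. L x) = (LINT x|completion M. max 0 (F k x))"
      unfolding L_def using transfer_integrable(2,3)[OF F_int] by auto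
    have FSuc: "F n x = g x + L x" for x by (simp add: F_def L_def Suc)
    have "(LINT x|completion M. max 0 (F k x)) \<le> (LINT x|completion M. max 0 (F n x))"
    proof (rule integral_mono_AE[OF F_int F_int])
      show "AE x in completion M. max 0 (F k x) \<le> max 0 (F n x)"
        using AE_H
      proof eventually_elim
        case (elim x)
        have "F k x \<le> F n x" unfolding F_def Suc by (rule tree.max_tree_sum_mono[OF H(2) reg elim])
        then show ?case by simp
      qed
    qed
    then have "0 \<le> (LINT x|completion M. max 0 (F n x) - L x)"
      using L F_int by simp
    also have "\<dots> \<le> (LINT x|completion M. indicator {x \<in> H. 0 < F n x} x *\<^sub>R g x)"
    proof (rule integral_mono_AE)
      show "integrable (completion M) (\<lambda>x. max 0 (F n x) - L x)" using L F_int by simp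
      show "integrable (completion M) (\<lambda>x. indicator {x \<in> H. 0 < F n x} x *\<^sub>R g x)"
        using sets g by (rule integrable_mult_indicator)
      show "AE x in completion M. max 0 (F n x) - L x \<le> indicator {x \<in> H. 0 < F n x} x *\<^sub>R g x"
        using AE_H
      proof eventually_elim
        case (elim x)
        have "0 \<le> L x" unfolding L_def by (rule tree.transfer_nonneg) simp
        then show ?case using elim FSuc[of x] by (auto simp: indicator_def)
      qed
    qed
    finally show ?thesis by (simp add: set_lebesgue_integral_def F_def)
  qed
qed

lemma maximal_inequality_zero:
  assumes g: "integrable (completion M) g" and H: "- H \<in> null_sets M" "\<And>y. T y \<in> H \<Longrightarrow> y \<in> H"
    and reg: "tree.regular_on H g"
  shows "{x \<in> H. \<exists>n. 0 < max_tree_sum T \<rho> g n x} \<in> sets (completion M)"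
    and "0 \<le> (LINT x:{x \<in> H. \<exists>n. 0 < max_tree_sum T \<rho> g n x}|completion M. g x)"
proof -
  define A where "A n = {x \<in> H. 0 < max_tree_sum T \<rho> g n x}" for n
  have A: "A n \<in> sets (completion M)" for n
    unfolding A_def by (rule level_set_in_sets[OF g H(1)])
  have UA: "{x \<in> H. \<exists>n. 0 < max_tree_sum T \<rho> g n x} = (\<Union>n. A n)" by (auto simp: A_def)
  then show "{x \<in> H. \<exists>n. 0 < max_tree_sum T \<rho> g n x} \<in> sets (completion M)" using A by auto
  have "incseq A"
  proof (rule incseq_SucI)
    show "A n \<subseteq> A (Suc n)" for n
      using tree.max_tree_sum_mono[OF H(2) reg, of _ n] unfolding A_def by (blast intro: less_le_trans)
  qed
  moreover have "set_integrable (completion M) (\<Union>n. A n) g"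
    unfolding set_integrable_def using A g by (intro integrable_mult_indicator) auto
  ultimately have "(\<lambda>n. LINT x:A n|completion M. g x) \<longlonglongrightarrow> (LINT x:(\<Union>n. A n)|completion M. g x)"
    using A by (intro set_integral_cont_up)
  moreover have "0 \<le> (LINT x:A n|completion M. g x)" for n
    unfolding A_def by (rule level_maximal_inequality[OF g H reg])
  ultimately show "0 \<le> (LINT x:{x \<in> H. \<exists>n. 0 < max_tree_sum T \<rho> g n x}|completion M. g x)"
    unfolding UA by (metis LIMSEQ_le_const)
qed

text \<open>
  A weighted average exceeds \<open>c\<close> exactly when the weighted sum of \<open>f - c\<close> is positive.  The dominating
  function \<open>\<bar>f\<bar> + \<bar>c\<bar> + 1\<close> bounds \<open>f\<close>, \<open>f - c\<close> and the constant \<open>1\<close>, so that all three sums converge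
  on every tree rooted in \<open>H\<close>.
\<close>
lemma max_fun_gt_iff:
  assumes H: "\<And>y. T y \<in> H \<Longrightarrow> y \<in> H" and x: "x \<in> H"
    and reg: "tree.regular_on H (\<lambda>x. f x - c)" "tree.regular_on H (\<lambda>x. \<bar>f x\<bar> + \<bar>c\<bar> + 1)"
  shows "max_fun T \<rho> f x > ereal c \<longleftrightarrow> (\<exists>n. 0 < max_tree_sum T \<rho> (\<lambda>x. f x - c) n x)"
proof -
  have dom: "\<bar>f z - c\<bar> \<le> \<bar>f z\<bar> + \<bar>c\<bar> + 1" for z by linarith
  have avg: "c < weighted_avg \<rho> f x \<tau> \<longleftrightarrow> 0 < (\<Sum>\<^sub>\<infinity>z\<in>\<tau>. (f z - c) * \<rho> x z)" if \<tau>: "\<tau> \<in> bounded_trees T n x" for \<tau> n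
  proof -
    have f: "(\<lambda>z. f z * \<rho> x z) summable_on \<tau>"
      by (rule tree.tree_sum_summable[OF H _ reg(2) x \<tau>]) auto
    have "(\<lambda>z. 1 * \<rho> x z) summable_on \<tau>"
      by (rule tree.tree_sum_summable[OF H _ reg(2) x \<tau>]) auto
    then have one: "\<rho> x summable_on \<tau>" by simp
    have pos: "0 < \<rho> x z" if "z \<in> \<tau>" for z
      using that tree.bounded_trees_subset_backward_orbit[OF \<tau>] tree.backward_orbit_related \<rho>_pos by blast
    have "x \<in> \<tau>" using \<tau> by (simp add: bounded_trees_def)
    have "(\<Sum>\<^sub>\<infinity>z\<in>{x}. \<rho> x z) \<le> (\<Sum>\<^sub>\<infinity>z\<in>\<tau>. \<rho> x z)"
      using one pos \<open>x \<in> \<tau>\<close> by (intro infsum_mono_neutral) (auto simp: less_imp_le)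
    then have P: "0 < (\<Sum>\<^sub>\<infinity>z\<in>\<tau>. \<rho> x z)" by simp
    have "(\<Sum>\<^sub>\<infinity>z\<in>\<tau>. (f z - c) * \<rho> x z) = (\<Sum>\<^sub>\<infinity>z\<in>\<tau>. f z * \<rho> x z + (- c) * \<rho> x z)"
      by (simp add: algebra_simps)
    also have "\<dots> = (\<Sum>\<^sub>\<infinity>z\<in>\<tau>. f z * \<rho> x z) + (\<Sum>\<^sub>\<infinity>z\<in>\<tau>. (- c) * \<rho> x z)"
      by (intro infsum_add f summable_on_cmult_right one)
    also have "\<dots> = (\<Sum>\<^sub>\<infinity>z\<in>\<tau>. f z * \<rho> x z) - c * (\<Sum>\<^sub>\<infinity>z\<in>\<tau>. \<rho> x z)"
      by (subst infsum_cmult_right') simp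
    finally show ?thesis unfolding weighted_avg_def using P by (simp add: pos_less_divide_eq)
  qed
  show ?thesis
  proof
    assume "ereal c < max_fun T \<rho> f x"
    then obtain \<tau> where "\<tau> \<in> rooted_trees T x" "c < weighted_avg \<rho> f x \<tau>"
      by (auto simp: max_fun_def less_SUP_iff)
    then obtain n where n: "\<tau> \<in> bounded_trees T n x" "0 < (\<Sum>\<^sub>\<infinity>z\<in>\<tau>. (f z - c) * \<rho> x z)"
      using avg by (auto simp: rooted_trees_eq)
    then have "0 < max_tree_sum T \<rho> (\<lambda>x. f x - c) n x"
      using tree.tree_sum_le_max[OF H dom reg(2,1) x n(1)] by linarith
    then show "\<exists>n. 0 < max_tree_sum T \<rho> (\<lambda>x. f x - c) n x" ..
  next
    assume "\<exists>n. 0 < max_tree_sum T \<rho> (\<lambda>x. f x - c) n x"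
    then obtain n where n: "0 < max_tree_sum T \<rho> (\<lambda>x. f x - c) n x" ..
    obtain \<tau> where \<tau>: "\<tau> \<in> bounded_trees T n x" "(\<Sum>\<^sub>\<infinity>z\<in>\<tau>. (f z - c) * \<rho> x z) = max_tree_sum T \<rho> (\<lambda>x. f x - c) n x"
      using tree.max_tree_sum_attained[OF H dom reg(2) x, of n] by blast
    then have "c < weighted_avg \<rho> f x \<tau>" using avg n by simp
    moreover have "\<tau> \<in> rooted_trees T x" using \<tau>(1) by (auto simp: rooted_trees_eq)
    ultimately show "ereal c < max_fun T \<rho> f x" by (auto simp: max_fun_def less_SUP_iff)
  qed
qed

lemma maximal_inequality:
  fixes c :: real
  assumes f: "integrable M f"
  shows "{x. max_fun T \<rho> f x > ereal c} \<in> sets (completion M)"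
    and "(LINT x:{x. max_fun T \<rho> f x > ereal c}|completion M. f x)
         \<ge> c * measure (completion M) {x. max_fun T \<rho> f x > ereal c}"
proof -
  interpret N: finite_measure "completion M"
    by (rule finite_measure_completion)
  have fN: "integrable (completion M) f" using f by (simp add: integrable_completion)
  have g: "integrable (completion M) (\<lambda>x. f x - c)" using fN by simp
  obtain H where H: "- H \<in> null_sets M" "\<And>y. T y \<in> H \<Longrightarrow> y \<in> H"
      "tree.regular_on H (\<lambda>x. f x - c)" "tree.regular_on H (\<lambda>x. \<bar>f x\<bar> + \<bar>c\<bar> + 1)"
    by (rule exists_regular_conull[OF g, of "\<lambda>x. \<bar>f x\<bar> + \<bar>c\<bar> + 1"]) (use fN in auto)
  define E where "E = {x. max_fun T \<rho> f x > ereal c}"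
  define E' where "E' = {x \<in> H. \<exists>n. 0 < max_tree_sum T \<rho> (\<lambda>x. f x - c) n x}"
  note zero = maximal_inequality_zero[OF g H(1,2,3), folded E'_def]
  have E': "E' = E \<inter> H" unfolding E'_def E_def using max_fun_gt_iff[OF H(2) _ H(3,4)] by auto
  have E_diff: "E - E' \<in> null_sets (completion M)"
    by (rule null_sets_completion_subset[OF _ null_sets_completionI[OF H(1)]]) (auto simp: E')
  moreover have "E = E' \<union> (E - E')" using E' by blast
  ultimately have E: "E \<in> sets (completion M)" using zero(1) by (metis null_setsD2 sets.Un)
  then show "{x. max_fun T \<rho> f x > ereal c} \<in> sets (completion M)" by (simp add: E_def)
  have "0 \<le> (LINT x:E'|completion M. f x - c)" by (rule zero(2))
  also have "\<dots> = (LINT x:E|completion M. f x - c)"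
  proof (rule set_integral_null_delta[OF g zero(1) E])
    show "E' - E \<union> (E - E') \<in> null_sets (completion M)"
      using E_diff E' by (simp add: Diff_eq_empty_iff[THEN iffD2])
  qed
  also have "\<dots> = (LINT x:E|completion M. f x) - (LINT x:E|completion M. c)"
    by (rule set_integral_diff; unfold set_integrable_def; rule integrable_mult_indicator[OF E]) (use fN in simp_all)
  also have "(LINT x:E|completion M. c) = c * measure (completion M) E"
    using E by (simp add: set_lebesgue_integral_def)
  finally show "(LINT x:{x. max_fun T \<rho> f x > ereal c}|completion M. f x)
         \<ge> c * measure (completion M) {x. max_fun T \<rho> f x > ereal c}" by (simp add: E_def)
qed

lemma max_fun_finite_AE:
  assumes f: "integrable M f"
  shows "AE x in M. max_fun T \<rho> f x < \<infinity>"
proof -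
  interpret N: finite_measure "completion M"
    by (rule finite_measure_completion)
  have fN: "integrable (completion M) f" using f by (simp add: integrable_completion)
  define E where "E c = {x. max_fun T \<rho> f x > ereal c}" for c
  define D where "D = {x. max_fun T \<rho> f x = \<infinity>}"
  have E: "E c \<in> sets (completion M)" for c unfolding E_def by (rule maximal_inequality(1)[OF f])
  have D: "D = (\<Inter>n. E (real n))"
  proof
    show "(\<Inter>n. E (real n)) \<subseteq> D"
    proof
      fix x assume "x \<in> (\<Inter>n. E (real n))"
      then have *: "ereal (real n) < max_fun T \<rho> f x" for n by (auto simp: E_def)
      have "max_fun T \<rho> f x = \<infinity>"
      proof (rule ereal_top)
        fix B :: real
        obtain n where "B < real n" using reals_Archimedean2 by blast
        then show "ereal B \<le> max_fun T \<rho> f x" using *[of n] by (meson ereal_less_eq(3) less_imp_le order_trans)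
      qed
      then show "x \<in> D" by (simp add: D_def)
    qed
  qed (auto simp: D_def E_def)
  then have D_sets: "D \<in> sets (completion M)" using E by auto
  define K where "K = (LINT x|completion M. \<bar>f x\<bar>)"
  have bound: "real n * measure (completion M) D \<le> K" for n
  proof -
    have "real n * measure (completion M) D \<le> real n * measure (completion M) (E (real n))"
      using E D by (intro mult_left_mono N.finite_measure_mono) auto
    also have "\<dots> \<le> (LINT x:E (real n)|completion M. f x)"
      using maximal_inequality(2)[OF f, of "real n"] by (simp add: E_def)
    also have "\<dots> \<le> K"
      unfolding K_def set_lebesgue_integral_def
      by (intro integral_mono integrable_mult_indicator E fN integrable_abs) (auto simp: indicator_def)
    finally show ?thesis .
  qed
  have "measure (completion M) D = 0"
  proof (rule ccontr)
    assume "measure (completion M) D \<noteq> 0"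
    then have "0 < measure (completion M) D" by (simp add: zero_less_measure_iff)
    then obtain n where "K < real n * measure (completion M) D" using reals_Archimedean3 by blast
    with bound[of n] show False by simp
  qed
  then have "D \<in> null_sets (completion M)" using D_sets by (auto simp: null_sets_def N.emeasure_eq_measure)
  then have "AE x in completion M. x \<notin> D" by (rule AE_not_in)
  then have "AE x in M. x \<notin> D" by (simp add: AE_completion_iff)
  then show ?thesis by eventually_elim (auto simp: D_def top.not_eq_extremum[symmetric] top_ereal_def)
qed

end

theorem theorem4p10:
  fixes M :: "'a::polish_space measure"
    and T :: "'a \<Rightarrow> 'a"
    and \<rho> :: "'a \<Rightarrow> 'a \<Rightarrow> real"
    and f :: "'a \<Rightarrow> real"
  assumes "prob_space M" and "sets M = sets borel"
    and "aperiodic T" and "countable_to_one T" and "measure_preserving M T" and "surj T"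
    and "null_preserving M (orbit_eqrel T)"
    and "RN_cocycle M (orbit_eqrel T) \<rho>"
    and "integrable M f"
  shows "(\<forall>c::real.
            {x. max_fun T \<rho> f x > ereal c} \<in> sets (completion M) \<and>
            (LINT x:{x. max_fun T \<rho> f x > ereal c}|completion M. f x)
              \<ge> c * measure (completion M) {x. max_fun T \<rho> f x > ereal c}) \<and>
         (AE x in M. max_fun T \<rho> f x < \<infinity>)"
proof -
  interpret aperiodic_cocycle_system M T \<rho>
    by (intro aperiodic_cocycle_system.intro nonsingular_cocycle_system.intro
        aperiodic_cocycle_system_axioms.intro assms)
  show ?thesis using maximal_inequality[OF assms(9)] max_fun_finite_AE[OF assms(9)] by blast
qed

end
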